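(* For every integer $r\geq 8$ there exists $n_0=n_0(r)$ such that for all $n>n_0$ the following holds. Let $A\subseteq[n]$ with $|A|\geq\lceil n/2\rceil+1$. (i) If $n$ is even, then $g(A,r)\leq r^{\lceil n/2\rceil+1}$, with equality if and only if $A=[n/2,n]$. (ii) If $n$ is odd, then $g(A,r)\leq r^{\lceil n/2\rceil}(3-2/r)$, with equality if and only if $A=[(n-1)/2,n]$.
   Context: $[n]=\{1,\dots,n\}$ and $[m,n]=\{m,m+1,\dots,n\}$. An $r$-coloring of $A$ is a map $A\to[r]$. A rainbow sum is a triple of three distinct elements $x,y,z$ with $x+y=z$ colored with three different colors; a coloring is rainbow sum-free if it has no rainbow sum. $g(A,r)$ is the number of rainbow sum-free $r$-colorings of $A$. *)

theory Defs
  imports Complex_Main "HOL-Library.FuncSet"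
begin

text \<open>Colorings are extensional functions, so that they can be counted.\<close>

definition colorings :: "nat set \<Rightarrow> nat \<Rightarrow> (nat \<Rightarrow> nat) set" where
  "colorings A r = A \<rightarrow>\<^sub>E {1..r}"

definition rainbow_sum :: "nat set \<Rightarrow> (nat \<Rightarrow> nat) \<Rightarrow> nat \<Rightarrow> nat \<Rightarrow> nat \<Rightarrow> bool" where
  "rainbow_sum A c x y z \<longleftrightarrow>
     x \<in> A \<and> y \<in> A \<and> z \<in> A \<and>
     x \<noteq> y \<and> x \<noteq> z \<and> y \<noteq> z \<and>
     x + y = z \<and>
     c x \<noteq> c y \<and> c x \<noteq> c z \<and> c y \<noteq> c z"

definition rainbow_sum_free :: "nat set \<Rightarrow> (nat \<Rightarrow> nat) \<Rightarrow> bool" where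
  "rainbow_sum_free A c \<longleftrightarrow> \<not> (\<exists>x y z. rainbow_sum A c x y z)"

definition g :: "nat set \<Rightarrow> nat \<Rightarrow> nat" where
  "g A r = card {c \<in> colorings A r. rainbow_sum_free A c}"

end

(* Write \<rho> = 3r - 2, the number of ways to color x, y so that {x, y, s} is not rainbow once the
   color of s is known. Since r \<ge> 8, \<rho>^2 < r^3: every triple of a family of triples that share
   only s costs a factor below r^(-1/2).

   If a = min A \<ge> n/3, the triples (a, y, y + a) with y > a are disjoint apart from a, and each
   element that A gains below n/2 creates enough of them to outweigh the extra colors.

   If some a \<in> A is at most n/3, the count is exponentially smaller than r^(n/2). Expose the
   colors of a small linear number of top elements M of A, and let S be the most popular color
   class in M, of color i. For x, y below M with x + y \<in> S, the colors of x and y agree or one of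
   them is i. In this dense graph a bounded number of further exposed vertices leaves palettes
   such that: W has all r colors, P at most two, everything else one, and W has few edges to
   W \<union> P. Reflection in the elements of S then gives 2|W| + |P| \<le> (1 + o(1)) n. As 2 \<le> r^(1/3),
   a large P makes the number of colorings small, and so does |W| noticeably below n/2.
   Otherwise W is almost half of [n], and some s \<in> A has linearly many disjoint triples in W: if
   not, adding any s \<in> A would flip membership in W (almost everywhere), while max A is itself a
   sum of two elements of A, which forces W to be concentrated on [n/2, n], where translation by
   a \<le> n/3 yields many pairs. *)
theory Submission
  imports Defs
begin

section \<open>Dense sets contain an element with many sums\<close>

text \<open>Assume the contrary. Reflection in \<open>z = Max A\<close> and translation by any
  \<open>s\<close> in \<open>A\<close> then flip membership in \<open>W\<close> up to
  \<open>O(k + e)\<close> exceptions. Combined along \<open>z = x + y\<close> with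
  \<open>x, y\<close> in \<open>A\<close>, this nearly empties \<open>W\<close> below
  \<open>y \<ge> z / 2\<close>. The rest of \<open>W\<close>, almost \<open>n / 2\<close> elements
  in an interval no longer than about \<open>n / 2\<close>, must contain many pairs at distance
  \<open>a \<le> n / 3\<close>.\<close>

lemma exists_many_sums:
  fixes W A :: "nat set"
  assumes "W \<subseteq> A" "A \<subseteq> {1..n}" "n + 2 \<le> 2 * card A" "a \<in> A" "3 * a \<le> n"
    and dense: "n \<le> 2 * card W + 2 * k" and large: "90 * k + 96 * e + 48 < n"
  shows "\<exists>s\<in>A. e < card {x\<in>W. x < s \<and> s - x \<in> W} \<or> e < card {x\<in>W. x + s \<in> W}"
proof (rule ccontr)
  assume "\<not> ?thesis"
  then have sum_few: "card {x\<in>W. x < s \<and> s - x \<in> W} \<le> e"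
    and diff_few: "card {x\<in>W. x + s \<in> W} \<le> e" if "s \<in> A" for s
    using that by (meson not_le)+
  have finA: "finite A" using assms(2) finite_subset by blast
  then have finW: "finite W" using assms(1) finite_subset by blast
  define z where "z = Max A"
  have zA: "z \<in> A" using Max_in[OF finA] assms(4) unfolding z_def by blast
  have A_le: "x \<le> z" "1 \<le> x" if "x \<in> A" for x
    using that finA assms(2) unfolding z_def by auto
  have zn: "z \<le> n" using zA assms(2) by auto
  \<comment> \<open>\<open>W\<close> and its reflection in \<open>z\<close> share at most
    \<open>e\<close> points, and each has at least about \<open>n / 2 - k\<close>. Together they
    nearly fill \<open>{1..<z}\<close>, so the uncovered set \<open>N\<close> is small.\<close>
  define N where "N = {t\<in>{1..<z}. t \<notin> W \<and> z - t \<notin> W}"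
  have finN: "finite N" unfolding N_def by simp
  have N_card: "card N \<le> 2 * k + 1 + e"
  proof -
    define W' where "W' = W \<inter> {1..<z}"
    define V where "V = (\<lambda>t. z - t) ` W'"
    have fin: "finite W'" "finite V" unfolding W'_def V_def using finW by auto
    have "inj_on (\<lambda>t. z - t) W'" unfolding W'_def by (auto simp: inj_on_def)
    then have cV: "card V = card W'" unfolding V_def by (rule card_image)
    have "W \<subseteq> insert z W'" unfolding W'_def using A_le assms(1) by fastforce
    then have "card W \<le> card (insert z W')" using fin by (intro card_mono) auto
    also have "\<dots> \<le> Suc (card W')" by (simp add: card_insert_le_m1)
    finally have cW: "card W \<le> Suc (card W')" .
    have "W' \<inter> V \<subseteq> {x\<in>W. x < z \<and> z - x \<in> W}" unfolding W'_def V_def by auto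
    then have "card (W' \<inter> V) \<le> card {x\<in>W. x < z \<and> z - x \<in> W}"
      by (intro card_mono) (simp_all add: finW)
    then have cI: "card (W' \<inter> V) \<le> e" using sum_few[OF zA] by linarith
    have cU: "card W' + card V = card (W' \<union> V) + card (W' \<inter> V)"
      using fin by (rule card_Un_Int)
    have sub: "W' \<union> V \<subseteq> {1..<z}" unfolding W'_def V_def by auto
    have "N = {1..<z} - (W' \<union> V)"
    proof
      show "N \<subseteq> {1..<z} - (W' \<union> V)" unfolding N_def W'_def V_def by auto
      show "{1..<z} - (W' \<union> V) \<subseteq> N"
      proof
        fix t assume t: "t \<in> {1..<z} - (W' \<union> V)"
        have "z - t \<notin> W"
        proof
          assume "z - t \<in> W"
          then have "z - t \<in> W'" unfolding W'_def using t by auto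
          then have "z - (z - t) \<in> V" unfolding V_def by blast
          then show False using t by auto
        qed
        then show "t \<in> N" using t unfolding N_def W'_def by auto
      qed
    qed
    then have "card N = z - 1 - card (W' \<union> V)" using sub fin by (simp add: card_Diff_subset)
    then show ?thesis using cU cI cV cW dense zn by linarith
  qed
  \<comment> \<open>If \<open>x\<close> and \<open>x + s\<close> both avoid \<open>W\<close>, then typically \<open>z - x\<close> and \<open>z - x - s\<close> both lie in \<open>W\<close>.\<close>
  have flip: "card {x\<in>{1..<z-s}. x \<notin> W \<and> x + s \<notin> W} \<le> 4 * k + 2 + 3 * e"
    if s: "s \<in> A" for s
  proof -
    define F where "F = {x\<in>{1..<z-s}. x \<notin> W \<and> x + s \<notin> W}"
    define Z1 where "Z1 = {x\<in>{1..<z-s}. x + s \<in> N}"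
    define Z2 where "Z2 = {x\<in>{1..<z-s}. z - x - s \<in> W \<and> z - x \<in> W}"
    have "card Z1 \<le> card N"
      by (rule card_inj_on_le[of "\<lambda>x. x + s"]) (auto simp: Z1_def finN)
    then have cZ1: "card Z1 \<le> 2 * k + 1 + e" using N_card by (rule order_trans)
    have "card Z2 \<le> card {x\<in>W. x + s \<in> W}"
      by (rule card_inj_on_le[of "\<lambda>x. z - x - s"]) (auto simp: Z2_def finW inj_on_def)
    then have cZ2: "card Z2 \<le> e" using diff_few[OF s] by (rule order_trans)
    have "F \<subseteq> N \<union> Z1 \<union> Z2"
      unfolding F_def N_def Z1_def Z2_def by auto
    then have "card F \<le> card (N \<union> Z1 \<union> Z2)"
      by (intro card_mono) (auto simp: finN Z1_def Z2_def)
    moreover have "card (N \<union> Z1 \<union> Z2) \<le> card N + card Z1 + card Z2"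
      by (meson add_mono card_Un_le le_refl le_trans)
    ultimately have "card F \<le> 4 * k + 2 + 3 * e"
      using cZ1 cZ2 N_card by linarith
    then show ?thesis unfolding F_def .
  qed
  \<comment> \<open>Pigeonhole: otherwise \<open>A - {z}\<close> and its reflection are disjoint in
    \<open>{1..<z}\<close>, so \<open>2 * card A - 2 \<le> n - 1\<close>, against
    \<open>n + 2 \<le> 2 * card A\<close>.\<close>
  have "\<exists>x\<in>A. x < z \<and> z - x \<in> A"
  proof (rule ccontr)
    assume none: "\<not> ?thesis"
    define A1 where "A1 = A - {z}"
    define V where "V = (\<lambda>t. z - t) ` A1"
    have A1: "x < z" "1 \<le> x" if "x \<in> A1" for x
      using that A_le[of x] unfolding A1_def by auto
    then have "inj_on (\<lambda>t. z - t) A1" by (auto simp: inj_on_def dest: less_imp_le_nat A1(1))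
    then have cV: "card V = card A1" unfolding V_def by (rule card_image)
    have fin: "finite A1" "finite V" unfolding A1_def V_def using finA by auto
    have "A1 \<inter> V = {}"
    proof (rule ccontr)
      assume "A1 \<inter> V \<noteq> {}"
      then obtain x where "x \<in> A1" "z - x \<in> A1" unfolding V_def by auto
      then show False using none A1 unfolding A1_def by auto
    qed
    then have "card A1 + card V = card (A1 \<union> V)" using fin by (simp add: card_Un_disjoint)
    also have "\<dots> \<le> card {1..<z}"
      using A1 by (intro card_mono) (force simp: V_def)+
    finally have "2 * card A1 \<le> z - 1" using cV by simp
    moreover have "card A1 = card A - 1" unfolding A1_def using zA by simp
    ultimately show False using assms(3) zn A_le(2)[OF zA] by linarith
  qed
  then obtain x where x: "x \<in> A" "x < z" "z - x \<in> A" by blast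
  obtain x y where xy: "x \<in> A" "y \<in> A" "x + y = z" "x \<le> y"
  proof (cases "x \<le> z - x")
    case True
    then show ?thesis using that[of x "z - x"] x by auto
  next
    case False
    then show ?thesis using that[of "z - x" x] x by auto
  qed
  \<comment> \<open>For \<open>t \<in> W\<close> below \<open>y\<close>, reflecting in \<open>y\<close> and adding \<open>x\<close> flips membership twice, so that
    typically \<open>z - t \<in> W\<close>, which is rare because \<open>z \<in> A\<close>.\<close>
  define Wy where "Wy = {t\<in>W. t < y}"
  have Wy_card: "card Wy \<le> 4 * k + 2 + 5 * e"
  proof -
    define Z1 where "Z1 = {t\<in>W. t < y \<and> y - t \<in> W}"
    define Z2 where "Z2 = {t\<in>W. t < z \<and> z - t \<in> W}"
    define Z3 where "Z3 = {t\<in>{1..<y}. y - t \<notin> W \<and> y - t + x \<notin> W}"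
    have "card Z1 \<le> e" "card Z2 \<le> e" unfolding Z1_def Z2_def by (rule sum_few; fact)+
    moreover have "card Z3 \<le> card {t\<in>{1..<z-x}. t \<notin> W \<and> t + x \<notin> W}"
      by (rule card_inj_on_le[of "\<lambda>t. y - t"]) (use xy in \<open>auto simp: Z3_def inj_on_def\<close>)
    moreover have "Wy \<subseteq> Z1 \<union> Z2 \<union> Z3"
    proof
      fix t assume "t \<in> Wy"
      then have "t \<in> W" "t < y" "1 \<le> t" "t < z" "y - t + x = z - t"
        using xy A_le(2) assms(1) unfolding Wy_def by auto
      then show "t \<in> Z1 \<union> Z2 \<union> Z3" unfolding Z1_def Z2_def Z3_def by auto
    qed
    then have "card Wy \<le> card (Z1 \<union> Z2 \<union> Z3)"
      by (intro card_mono) (auto simp: finW Z1_def Z2_def Z3_def)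
    moreover have "card (Z1 \<union> Z2 \<union> Z3) \<le> card Z1 + card Z2 + card Z3"
      by (meson add_mono card_Un_le le_refl le_trans)
    ultimately show ?thesis using flip[OF xy(1)] by linarith
  qed
  define W2 where "W2 = W \<inter> {y..z}"
  have "W \<subseteq> Wy \<union> W2" unfolding Wy_def W2_def using A_le assms(1) by auto
  then have "card W \<le> card (Wy \<union> W2)"
    by (intro card_mono) (auto simp: finW Wy_def W2_def)
  then have W2: "card W \<le> card Wy + card W2" using card_Un_le[of Wy W2] by linarith
  \<comment> \<open>Few \<open>t\<close> have both \<open>t\<close> and \<open>t + a\<close> in
    \<open>W\<close>, so the gaps \<open>Z\<close> and their shift by \<open>a\<close> cover almost
    all of \<open>{y..z-a}\<close>. Hence \<open>2 * card W2\<close> is at most about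
    \<open>(z - y) + a \<le> n / 2 + n / 3\<close>, short of the \<open>n\<close> that density
    demands.\<close>
  define Z where "Z = {y..z} - W"
  have "Z = {y..z} - W2" unfolding Z_def W2_def by auto
  then have Z: "card Z + card W2 = z + 1 - y"
    using card_Diff_subset[of W2 "{y..z}"] card_mono[of "{y..z}" W2] finW unfolding W2_def by simp
  define Z' where "Z' = {t\<in>{y..z-a}. t + a \<in> Z}"
  have "card Z' \<le> card Z"
    by (rule card_inj_on_le[of "\<lambda>t. t + a"]) (auto simp: Z'_def Z_def)
  moreover have "{y..z-a} \<subseteq> Z \<union> Z' \<union> {t\<in>W. t + a \<in> W}"
    unfolding Z_def Z'_def using A_le(1)[OF assms(4)] by auto
  then have "card {y..z-a} \<le> card (Z \<union> Z' \<union> {t\<in>W. t + a \<in> W})"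
    by (intro card_mono) (auto simp: Z_def Z'_def finW)
  moreover have "card (Z \<union> Z' \<union> {t\<in>W. t + a \<in> W}) \<le> card Z + card Z' + card {t\<in>W. t + a \<in> W}"
    by (meson add_mono card_Un_le le_refl le_trans)
  ultimately have "z - a + 1 - y \<le> 2 * card Z + e" using diff_few[OF assms(4)] by simp
  moreover have "a \<le> z" "y \<le> z" "z \<le> 2 * y" using A_le assms(4) xy by auto
  ultimately have "2 * card W2 \<le> (z - y) + 1 + a + e" using Z by linarith
  then show False using W2 Wy_card \<open>z \<le> 2 * y\<close> \<open>y \<le> z\<close> zn large dense assms(5) by linarith
qed

section \<open>Counting colorings with prescribed palettes\<close>

text \<open>There are \<open>r\<close> diagonal pairs and \<open>2 * (r - 1)\<close> off-diagonal
  pairs with one entry \<open>j\<close>.\<close>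

lemma card_compatible_pairs:
  assumes "j \<in> {1..r::nat}"
  shows "card {(a, b). a \<in> {1..r} \<and> b \<in> {1..r} \<and> (a = b \<or> a = j \<or> b = j)} = 3 * r - 2"
proof -
  let ?R = "{1..r} - {j}"
  have "{(a, b). a \<in> {1..r} \<and> b \<in> {1..r} \<and> (a = b \<or> a = j \<or> b = j)} =
      (\<lambda>a. (a, a)) ` {1..r} \<union> ({j} \<times> ?R \<union> ?R \<times> {j})"
    using assms by auto
  also have "card \<dots> = card ((\<lambda>a. (a, a)) ` {1..r}) + (card ({j} \<times> ?R) + card (?R \<times> {j}))"
    by (subst card_Un_disjoint; (subst card_Un_disjoint)?) auto
  also have "card ((\<lambda>a. (a, a)) ` {1..r}) = r"
    by (subst card_image) (auto simp: inj_on_def)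
  finally show ?thesis using assms by (simp add: card_cartesian_product)
qed

text \<open>The pairs \<open>{x, \<phi> x}\<close> are disjoint, so for a fixed \<open>j\<close> a
  coloring is an independent choice of a compatible pair at each \<open>x\<close> in
  \<open>Q\<close> and of a palette color at every other point. \<open>f\<close> splits a coloring
  in this way and \<open>h\<close> reassembles it.\<close>

lemma card_pair_compatible_PiE:
  fixes pal :: "'a \<Rightarrow> nat set" and \<phi> :: "'a \<Rightarrow> 'a"
  assumes fin: "finite A" and Q: "Q \<subseteq> A" "\<phi> ` Q \<subseteq> A" "inj_on \<phi> Q" "Q \<inter> \<phi> ` Q = {}"
    and j: "j \<in> {1..r}" and full: "\<And>x. x \<in> Q \<union> \<phi> ` Q \<Longrightarrow> pal x = {1..r}"
  shows "card {c \<in> PiE A pal. \<forall>x\<in>Q. c x = c (\<phi> x) \<or> c x = j \<or> c (\<phi> x) = j} =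
    (3 * r - 2) ^ card Q * (\<Prod>x\<in>A - (Q \<union> \<phi> ` Q). card (pal x))"
proof -
  define C where "C = {c \<in> PiE A pal. \<forall>x\<in>Q. c x = c (\<phi> x) \<or> c x = j \<or> c (\<phi> x) = j}"
  define D where "D = A - (Q \<union> \<phi> ` Q)"
  define P where "P = {(a, b). a \<in> {1..r} \<and> b \<in> {1..r} \<and> (a = b \<or> a = j \<or> b = j)}"
  define f where "f c = (restrict (\<lambda>x. (c x, c (\<phi> x))) Q, restrict c D)" for c :: "'a \<Rightarrow> nat"
  define h where "h pd = (\<lambda>x\<in>A. if x \<in> Q then fst (fst pd x)
      else if x \<in> \<phi> ` Q then snd (fst pd (inv_into Q \<phi> x)) else snd pd x)"
    for pd :: "('a \<Rightarrow> nat \<times> nat) \<times> ('a \<Rightarrow> nat)"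
  have inv: "inv_into Q \<phi> (\<phi> x) = x" if "x \<in> Q" for x using that Q(3) by simp
  have notQ: "\<phi> x \<notin> Q" if "x \<in> Q" for x using that Q(4) by auto
  have "bij_betw f C (PiE Q (\<lambda>_. P) \<times> PiE D pal)"
  proof (rule bij_betw_byWitness[where f' = h])
    show "\<forall>c\<in>C. h (f c) = c"
    proof
      fix c assume "c \<in> C"
      then have c: "c \<in> PiE A pal" unfolding C_def by simp
      show "h (f c) = c"
      proof
        fix x
        consider "x \<notin> A" | "x \<in> Q" | y where "x = \<phi> y" "y \<in> Q" | "x \<in> D"
          unfolding D_def by blast
        then show "h (f c) x = c x"
        proof cases
          case 1
          then show ?thesis using PiE_arb[OF c] by (simp add: h_def)
        next
          case 2
          moreover from this have "x \<in> A" using Q(1) by blast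
          ultimately show ?thesis by (simp add: h_def f_def)
        next
          case (3 y)
          moreover from this have "x \<in> A" using Q(2) by blast
          ultimately show ?thesis using inv[of y] notQ[of y] by (simp add: h_def f_def)
        next
          case 4
          then show ?thesis unfolding h_def f_def D_def by simp
        qed
      qed
    qed
    show "\<forall>pd\<in>PiE Q (\<lambda>_. P) \<times> PiE D pal. f (h pd) = pd"
    proof
      fix pd assume "pd \<in> PiE Q (\<lambda>_. P) \<times> PiE D pal"
      then obtain p d where pd: "pd = (p, d)" "p \<in> PiE Q (\<lambda>_. P)" "d \<in> PiE D pal" by blast
      have "restrict (\<lambda>x. (h pd x, h pd (\<phi> x))) Q = p"
      proof
        fix x show "restrict (\<lambda>x. (h pd x, h pd (\<phi> x))) Q x = p x"
        proof (cases "x \<in> Q")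
          case True
          then have "x \<in> A" "\<phi> x \<in> A" "\<phi> x \<in> \<phi> ` Q" using Q(1,2) by auto
          then show ?thesis using True inv[OF True] notQ[OF True] by (simp add: h_def pd(1))
        next
          case False
          then show ?thesis using PiE_arb[OF pd(2)] by simp
        qed
      qed
      moreover have "restrict (h pd) D = d"
      proof
        fix x show "restrict (h pd) D x = d x"
        proof (cases "x \<in> D")
          case True
          then have "x \<in> A" "x \<notin> Q" "x \<notin> \<phi> ` Q" unfolding D_def by auto
          then show ?thesis using True by (simp add: h_def pd(1))
        next
          case False
          then show ?thesis using PiE_arb[OF pd(3)] by simp
        qed
      qed
      ultimately show "f (h pd) = pd" using pd(1) unfolding f_def by simp
    qed
    show "f ` C \<subseteq> PiE Q (\<lambda>_. P) \<times> PiE D pal"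
    proof (rule image_subsetI)
      fix c assume "c \<in> C"
      then have c: "c \<in> PiE A pal" "\<forall>x\<in>Q. c x = c (\<phi> x) \<or> c x = j \<or> c (\<phi> x) = j"
        unfolding C_def by auto
      have "c x \<in> {1..r} \<and> c (\<phi> x) \<in> {1..r}" if "x \<in> Q" for x
      proof
        have "x \<in> A" "\<phi> x \<in> A" using that Q(1,2) by auto
        moreover have "pal x = {1..r}" "pal (\<phi> x) = {1..r}" using that by (intro full; simp)+
        ultimately show "c x \<in> {1..r}" "c (\<phi> x) \<in> {1..r}" using PiE_mem[OF c(1)] by metis+
      qed
      then have "restrict (\<lambda>x. (c x, c (\<phi> x))) Q \<in> PiE Q (\<lambda>_. P)"
        using c(2) unfolding P_def by auto
      moreover have "restrict c D \<in> PiE D pal" using c(1) unfolding D_def by auto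
      ultimately show "f c \<in> PiE Q (\<lambda>_. P) \<times> PiE D pal" unfolding f_def by simp
    qed
    show "h ` (PiE Q (\<lambda>_. P) \<times> PiE D pal) \<subseteq> C"
    proof (rule image_subsetI)
      fix pd assume "pd \<in> PiE Q (\<lambda>_. P) \<times> PiE D pal"
      then obtain p d where pd: "pd = (p, d)" "p \<in> PiE Q (\<lambda>_. P)" "d \<in> PiE D pal" by blast
      have pP: "fst (p x) \<in> {1..r} \<and> snd (p x) \<in> {1..r} \<and>
          (fst (p x) = snd (p x) \<or> fst (p x) = j \<or> snd (p x) = j)" if "x \<in> Q" for x
        using PiE_mem[OF pd(2) that] unfolding P_def by auto
      have hQ: "h pd x = fst (p x)" "h pd (\<phi> x) = snd (p x)" if "x \<in> Q" for x
      proof -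
        have "x \<in> A" "\<phi> x \<in> A" "\<phi> x \<in> \<phi> ` Q" using that Q(1,2) by auto
        then show "h pd x = fst (p x)" "h pd (\<phi> x) = snd (p x)"
          using that inv[OF that] notQ[OF that] by (simp_all add: h_def pd(1))
      qed
      have "h pd x \<in> pal x" if "x \<in> A" for x
      proof (cases "x \<in> Q \<union> \<phi> ` Q")
        case True
        then consider "x \<in> Q" | y where "x = \<phi> y" "y \<in> Q" by blast
        then have "h pd x \<in> {1..r}" using hQ pP by cases metis+
        then show ?thesis using full[OF True] by simp
      next
        case False
        then have "x \<in> D" using that unfolding D_def by simp
        then have "d x \<in> pal x" using PiE_mem[OF pd(3)] by blast
        then show ?thesis using False that by (simp add: h_def pd(1))
      qed
      moreover have "h pd x = undefined" if "x \<notin> A" for x using that by (simp add: h_def)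
      ultimately have "h pd \<in> PiE A pal" by (intro PiE_I)
      then show "h pd \<in> C" unfolding C_def using hQ pP by simp
    qed
  qed
  then have "card C = card (PiE Q (\<lambda>_. P) \<times> PiE D pal)" by (rule bij_betw_same_card)
  also have "\<dots> = card P ^ card Q * (\<Prod>x\<in>D. card (pal x))"
    using fin finite_subset[OF Q(1) fin] unfolding D_def by (simp add: card_cartesian_product card_PiE)
  also have "card P = 3 * r - 2" unfolding P_def by (rule card_compatible_pairs[OF j])
  finally show ?thesis unfolding C_def D_def .
qed

text \<open>Split by the color \<open>j\<close> of the center \<open>s\<close>. Shrinking the
  palette of \<open>s\<close> to \<open>{j}\<close> reduces each class to the previous count, and
  \<open>s\<close> lies in no pair, so the full palettes are untouched.\<close>

lemma card_PiE_star_free: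
  fixes pal :: "'a \<Rightarrow> nat set" and \<phi> :: "'a \<Rightarrow> 'a"
  assumes fin: "finite A" and Q: "Q \<subseteq> A" "\<phi> ` Q \<subseteq> A" "inj_on \<phi> Q" "Q \<inter> \<phi> ` Q = {}"
    and s: "s \<in> A" "s \<notin> Q" "s \<notin> \<phi> ` Q"
    and full: "\<And>x. x \<in> Q \<union> \<phi> ` Q \<Longrightarrow> pal x = {1..r}" and pal: "\<And>x. x \<in> A \<Longrightarrow> pal x \<subseteq> {1..r}"
  shows "card {c \<in> PiE A pal. \<forall>x\<in>Q. c x = c (\<phi> x) \<or> c x = c s \<or> c (\<phi> x) = c s} =
    card (pal s) * ((3 * r - 2) ^ card Q * (\<Prod>x\<in>A - (Q \<union> \<phi> ` Q) - {s}. card (pal x)))"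
proof -
  define C where "C j = {c \<in> PiE A (pal(s := {j})).
      \<forall>x\<in>Q. c x = c (\<phi> x) \<or> c x = j \<or> c (\<phi> x) = j}" for j
  have C_s: "c s = j" if "c \<in> C j" for c j
    using that PiE_mem[of c A "pal(s := {j})" s] s(1) unfolding C_def by simp
  have cardC: "card (C j) = (3 * r - 2) ^ card Q * (\<Prod>x\<in>A - (Q \<union> \<phi> ` Q) - {s}. card (pal x))"
    if "j \<in> pal s" for j
  proof -
    have "card (C j) = (3 * r - 2) ^ card Q *
        (\<Prod>x\<in>A - (Q \<union> \<phi> ` Q). card ((pal(s := {j})) x))"
      unfolding C_def
    proof (rule card_pair_compatible_PiE[OF fin Q])
      show "j \<in> {1..r}" using that pal[OF s(1)] by auto
      show "(pal(s := {j})) x = {1..r}" if "x \<in> Q \<union> \<phi> ` Q" for x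
        using that full[OF that] s by auto
    qed
    also have "(\<Prod>x\<in>A - (Q \<union> \<phi> ` Q). card ((pal(s := {j})) x)) =
        (\<Prod>x\<in>A - (Q \<union> \<phi> ` Q) - {s}. card ((pal(s := {j})) x))"
      using fin s by (subst prod.remove[of _ s]) auto
    also have "\<dots> = (\<Prod>x\<in>A - (Q \<union> \<phi> ` Q) - {s}. card (pal x))"
      by (intro prod.cong) auto
    finally show ?thesis .
  qed
  have "{c \<in> PiE A pal. \<forall>x\<in>Q. c x = c (\<phi> x) \<or> c x = c s \<or> c (\<phi> x) = c s} = (\<Union>j\<in>pal s. C j)"
  proof (intro equalityI subsetI)
    fix c assume c: "c \<in> {c \<in> PiE A pal. \<forall>x\<in>Q. c x = c (\<phi> x) \<or> c x = c s \<or> c (\<phi> x) = c s}"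
    then have "c s \<in> pal s" using s(1) by auto
    moreover have "c \<in> C (c s)" using c unfolding C_def by (auto simp: PiE_iff)
    ultimately show "c \<in> (\<Union>j\<in>pal s. C j)" by blast
  next
    fix c assume "c \<in> (\<Union>j\<in>pal s. C j)"
    then obtain j where j: "j \<in> pal s" "c \<in> C j" by blast
    have "c x \<in> pal x" if "x \<in> A" for x
      using that j PiE_mem[of c A "pal(s := {j})" x] unfolding C_def by (cases "x = s") auto
    then show "c \<in> {c \<in> PiE A pal. \<forall>x\<in>Q. c x = c (\<phi> x) \<or> c x = c s \<or> c (\<phi> x) = c s}"
      using C_s[OF j(2)] j(2) unfolding C_def by (auto simp: PiE_iff)
  qed
  also have "card \<dots> = (\<Sum>j\<in>pal s. card (C j))"
  proof (rule card_UN_disjoint)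
    have finp: "finite (pal x)" if "x \<in> A" for x using pal[OF that] finite_subset by blast
    then show "finite (pal s)" using s(1) .
    have "finite (PiE A (pal(s := {j})))" for j using fin finp by (intro finite_PiE) auto
    then show "\<forall>j\<in>pal s. finite (C j)" unfolding C_def by simp
    show "\<forall>i\<in>pal s. \<forall>j\<in>pal s. i \<noteq> j \<longrightarrow> C i \<inter> C j = {}" using C_s by blast
  qed
  finally show ?thesis using cardC by simp
qed

text \<open>The two alternatives serve the two kinds of stars at \<open>s\<close>: reflection
  \<open>y = s - x\<close> and translation \<open>y = x + s\<close>.\<close>

lemma rainbow_sum_free_triple:
  assumes "rainbow_sum_free A c" "x \<in> A" "y \<in> A" "s \<in> A" "x \<noteq> y" "x \<noteq> s" "y \<noteq> s"
    and "x + y = s \<or> x + s = y"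
  shows "c x = c y \<or> c x = c s \<or> c y = c s"
proof -
  have "\<not> rainbow_sum A c x y s" "\<not> rainbow_sum A c x s y"
    using assms(1) unfolding rainbow_sum_free_def by blast+
  then show ?thesis using assms(2-8) unfolding rainbow_sum_def by metis
qed

text \<open>For \<open>r \<ge> 9\<close> use \<open>9 * r^2 \<le> r^3\<close>; for
  \<open>r = 8\<close> it reads \<open>484 < 512\<close>. At \<open>r = 7\<close> it fails, since
  \<open>361 > 343\<close>.\<close>

lemma three_r_sq_less_cube:
  assumes "r \<ge> (8::nat)"
  shows "(3 * r - 2)\<^sup>2 < r ^ 3"
proof (cases "r = 8")
  case False
  then have "9 * r ^ 2 \<le> r * r ^ 2" using assms by (intro mult_right_mono) linarith+
  moreover have "(3 * r - 2)\<^sup>2 < (3 * r)\<^sup>2" using assms by (intro power_strict_mono) auto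
  moreover have "r * r ^ 2 = r ^ 3" "(3 * r)\<^sup>2 = 9 * r ^ 2"
    by (simp_all add: power2_eq_square power3_eq_cube)
  ultimately show ?thesis by linarith
qed simp

text \<open>This is \<open>\<rho> < r^(3/2)\<close>, squared to keep the exponents in the naturals.
  Strictness comes from \<open>1 \<le> p\<close>.\<close>

lemma three_r_power_less:
  assumes r: "r \<ge> (8::nat)" and p: "1 \<le> p" "3 * p + 2 * u \<le> 2 * v"
  shows "(3 * r - 2) ^ p * r ^ u < r ^ v"
proof -
  have "((3 * r - 2) ^ p * r ^ u)\<^sup>2 = ((3 * r - 2)\<^sup>2) ^ p * r ^ (2 * u)"
    by (simp add: power_mult_distrib flip: power_mult) (simp add: mult.commute)
  also have "\<dots> < (r ^ 3) ^ p * r ^ (2 * u)"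
    using three_r_sq_less_cube[OF r] p r by (intro mult_strict_right_mono power_strict_mono) auto
  also have "\<dots> = r ^ (3 * p + 2 * u)" by (simp add: power_add flip: power_mult)
  also have "\<dots> \<le> r ^ (2 * v)" using p r by (intro power_increasing) auto
  also have "\<dots> = (r ^ v)\<^sup>2" by (simp add: mult.commute flip: power_mult)
  finally show ?thesis by (rule power2_less_imp_less) simp
qed

lemma finite_colorings: "finite A \<Longrightarrow> finite (colorings A r)"
  unfolding colorings_def by (intro finite_PiE) auto

section \<open>Sets without small elements\<close>

text \<open>The triples \<open>(a, y, y + a)\<close> form a star at the minimum \<open>a\<close>:
  since \<open>y + 2 * a > 3 * a \<ge> n\<close>, they meet only in \<open>a\<close>. Each gap of
  \<open>A\<close> in \<open>{a..n}\<close> spoils at most one of the \<open>n - 2 * a\<close>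
  candidates \<open>y\<close>, which gives the lower bound on the number \<open>q\<close> of
  triples.\<close>

lemma g_min_bound:
  assumes A: "a \<in> A" "\<And>x. x \<in> A \<Longrightarrow> a \<le> x \<and> x \<le> n" "0 < a" "n \<le> 3 * a"
  obtains q where "card A \<le> q + a + 1" "2 * q + 1 \<le> card A"
    "g A r \<le> r * ((3 * r - 2) ^ q * r ^ (card A - 1 - 2 * q))"
proof -
  have "A \<subseteq> {a..n}" using A(2) by auto
  then have finA: "finite A" using finite_subset by blast
  have an: "a \<le> n" using A(1,2) by blast
  define Q where "Q = {y\<in>A. a < y \<and> y + a \<in> A}"
  define \<phi> where "\<phi> = (\<lambda>y::nat. y + a)"
  have finQ: "finite Q" unfolding Q_def using finA by simp
  have Q: "Q \<subseteq> A" "\<phi> ` Q \<subseteq> A" "inj_on \<phi> Q" "Q \<inter> \<phi> ` Q = {}"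
  proof -
    show "Q \<inter> \<phi> ` Q = {}"
    proof (rule ccontr)
      assume "Q \<inter> \<phi> ` Q \<noteq> {}"
      then obtain y where "y \<in> Q" "\<phi> y \<in> Q" by auto
      then have "y + a + a \<in> A" "a < y" unfolding Q_def \<phi>_def by auto
      then show False using A(2)[of "y + a + a"] A(4) by simp
    qed
  qed (auto simp: Q_def \<phi>_def)
  have aQ: "a \<notin> Q" "a \<notin> \<phi> ` Q" unfolding Q_def \<phi>_def using A(3) by auto
  have cQ: "card (Q \<union> \<phi> ` Q) = 2 * card Q"
    using Q(3,4) finQ by (simp add: card_Un_disjoint card_image)
  have rest: "card (A - (Q \<union> \<phi> ` Q) - {a}) = card A - 1 - 2 * card Q"
  proof -
    have "A - (Q \<union> \<phi> ` Q) - {a} = A - insert a (Q \<union> \<phi> ` Q)" by auto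
    moreover have "card (insert a (Q \<union> \<phi> ` Q)) = Suc (2 * card Q)"
      using cQ aQ finQ by (subst card_insert_disjoint) auto
    moreover have "insert a (Q \<union> \<phi> ` Q) \<subseteq> A" using Q(1,2) A(1) by auto
    ultimately show ?thesis using finQ by (simp add: card_Diff_subset)
  qed
  show thesis
  proof
    have "insert a (Q \<union> \<phi> ` Q) \<subseteq> A" using Q(1,2) A(1) by auto
    then have "card (insert a (Q \<union> \<phi> ` Q)) \<le> card A" using finA card_mono by blast
    moreover have "card (insert a (Q \<union> \<phi> ` Q)) = Suc (2 * card Q)"
      using cQ aQ finQ by (subst card_insert_disjoint) auto
    ultimately show "2 * card Q + 1 \<le> card A" by simp
    show "card A \<le> card Q + a + 1"
    proof -
      define Y where "Y = {a+1..n-a} - Q"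
      \<comment> \<open>Since \<open>n - a < 2 * a + 1\<close>, a missing element spoils at most one candidate \<open>y\<close>.\<close>
      define f where "f y = (if y \<in> A then y + a else y)" for y
      have "card Y \<le> card ({a..n} - A)"
      proof (rule card_inj_on_le[of f])
        show "inj_on f Y"
          unfolding inj_on_def f_def Y_def using A(4) by (auto split: if_splits)
        show "f ` Y \<subseteq> {a..n} - A" unfolding f_def Y_def Q_def by auto
      qed simp
      moreover have "card ({a..n} - A) + card A = n + 1 - a"
        using \<open>A \<subseteq> {a..n}\<close> finA an card_mono[of "{a..n}" A] by (simp add: card_Diff_subset)
      moreover have "card {a+1..n-a} \<le> card (Y \<union> Q)"
        unfolding Y_def using finQ by (intro card_mono) auto
      then have "n - a - a \<le> card Y + card Q" using card_Un_le[of Y Q] by simp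
      ultimately show ?thesis using an by linarith
    qed
    have "{c \<in> colorings A r. rainbow_sum_free A c} \<subseteq>
        {c \<in> PiE A (\<lambda>_. {1..r}). \<forall>x\<in>Q. c x = c (\<phi> x) \<or> c x = c a \<or> c (\<phi> x) = c a}"
    proof (intro subsetI CollectI conjI ballI)
      fix c assume c: "c \<in> {c \<in> colorings A r. rainbow_sum_free A c}"
      show "c \<in> PiE A (\<lambda>_. {1..r})" using c unfolding colorings_def by simp
      fix x assume "x \<in> Q"
      then have "x \<in> A" "\<phi> x \<in> A" "x \<noteq> \<phi> x" "x \<noteq> a" "\<phi> x \<noteq> a" "x + \<phi> x = a \<or> x + a = \<phi> x"
        unfolding Q_def \<phi>_def using A(3) by auto
      then show "c x = c (\<phi> x) \<or> c x = c a \<or> c (\<phi> x) = c a"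
        using rainbow_sum_free_triple[of A c x "\<phi> x" a] c A(1) by blast
    qed
    then have "g A r \<le> card {c \<in> PiE A (\<lambda>_. {1..r}).
        \<forall>x\<in>Q. c x = c (\<phi> x) \<or> c x = c a \<or> c (\<phi> x) = c a}"
      unfolding g_def using finite_colorings[OF finA, of r] unfolding colorings_def
      by (intro card_mono) auto
    also have "\<dots> = card {1..r} * ((3 * r - 2) ^ card Q *
        (\<Prod>x\<in>A - (Q \<union> \<phi> ` Q) - {a}. card {1..r}))"
      by (rule card_PiE_star_free[OF finA Q A(1) aQ]) auto
    finally show "g A r \<le> r * ((3 * r - 2) ^ card Q * r ^ (card A - 1 - 2 * card Q))"
      using rest by simp
  qed
qed

lemma g_less_even:
  assumes r: "r \<ge> 8" and A: "a \<in> A" "\<And>x. x \<in> A \<Longrightarrow> a \<le> x \<and> x \<le> 2 * m"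
    and a: "0 < a" "a < m" "2 * m \<le> 3 * a" and "m + 1 \<le> card A"
  shows "g A r < r ^ (m + 1)"
proof -
  obtain q where q: "card A \<le> q + a + 1" "2 * q + 1 \<le> card A"
    "g A r \<le> r * ((3 * r - 2) ^ q * r ^ (card A - 1 - 2 * q))"
    using g_min_bound[OF A a(1,3)] by blast
  have "A \<subseteq> {a..2*m}" using A(2) by auto
  then have cA: "card A \<le> 2 * m + 1 - a" using card_mono[of "{a..2*m}" A] by simp
  obtain e where e: "card A = 2 * q + 1 + e" using q(2) le_Suc_ex by blast
  have "r * ((3 * r - 2) ^ q * r ^ (card A - 1 - 2 * q)) = (3 * r - 2) ^ q * r ^ Suc e"
    using e by simp
  also have "\<dots> < r ^ (m + 1)"
  proof (rule three_r_power_less[OF r])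
    \<comment> \<open>The left side is \<open>2 * card A - 2 - q\<close>. The lower bound on
      \<open>q\<close> makes it at most \<open>card A + a - 1\<close>, and
      \<open>card A \<le> 2 * m + 1 - a\<close>.\<close>
    have "3 * q + 2 * e \<le> 2 * m" using q(1) e cA a by linarith
    then show "3 * q + 2 * Suc e \<le> 2 * (m + 1)" by simp
    show "1 \<le> q" using q(1) a assms(7) by linarith
  qed
  finally show ?thesis using q(3) by (rule le_less_trans[rotated])
qed

text \<open>The target already contains one factor \<open>3 * r - 2\<close>, so only
  \<open>q - 1\<close> triples enter the comparison. The larger cardinality ensures
  \<open>q \<ge> 2\<close>.\<close>

lemma g_less_odd:
  assumes r: "r \<ge> 8" and A: "a \<in> A" "\<And>x. x \<in> A \<Longrightarrow> a \<le> x \<and> x \<le> 2 * m + 1"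
    and a: "0 < a" "a < m" "2 * m + 1 \<le> 3 * a" and "m + 2 \<le> card A"
  shows "g A r < r ^ m * (3 * r - 2)"
proof -
  obtain q where q: "card A \<le> q + a + 1" "2 * q + 1 \<le> card A"
    "g A r \<le> r * ((3 * r - 2) ^ q * r ^ (card A - 1 - 2 * q))"
    using g_min_bound[OF A a(1,3)] by blast
  have "A \<subseteq> {a..2*m+1}" using A(2) by auto
  then have cA: "card A \<le> 2 * m + 2 - a" using card_mono[of "{a..2*m+1}" A] by simp
  have q2: "2 \<le> q" using q(1) a assms(7) by linarith
  obtain e where e: "card A = 2 * q + 1 + e" using q(2) le_Suc_ex by blast
  have "r * ((3 * r - 2) ^ q * r ^ (card A - 1 - 2 * q)) =
      (3 * r - 2) ^ (q - 1) * r ^ Suc e * (3 * r - 2)"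
    using q2 e by (cases q) simp_all
  also have "\<dots> < r ^ m * (3 * r - 2)"
  proof (intro mult_strict_right_mono three_r_power_less[OF r])
    have "3 * q + 2 * e \<le> 2 * m + 1" using q(1) e cA a by linarith
    then show "3 * (q - 1) + 2 * Suc e \<le> 2 * m" using q2 by (simp add: diff_mult_distrib2)
    show "1 \<le> q - 1" using q2 by simp
    show "0 < 3 * r - 2" using r by simp
  qed
  finally show ?thesis using q(3) by (rule le_less_trans[rotated])
qed

text \<open>Two distinct elements sum to at least \<open>2 * m + 1\<close>, so every coloring
  counts.\<close>

lemma g_upper_half_even:
  assumes "0 < m"
  shows "g {m..2*m} r = r ^ (m + 1)"
proof -
  have "rainbow_sum_free {m..2*m} c" for c
    unfolding rainbow_sum_free_def rainbow_sum_def using assms by auto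
  then show ?thesis unfolding g_def colorings_def by (simp add: card_PiE)
qed

text \<open>The only sum of distinct elements is \<open>m + (m + 1) = 2 * m + 1\<close>: a star at
  \<open>m\<close> with one pair, leaving \<open>m - 1\<close> free elements.\<close>

lemma g_upper_half_odd:
  assumes "0 < m"
  shows "g {m..2*m+1} r = r ^ m * (3 * r - 2)"
proof -
  define A where "A = {m..2*m+1}"
  define \<phi> where "\<phi> = (\<lambda>_::nat. 2 * m + 1)"
  have "rainbow_sum_free A c \<longleftrightarrow> (\<forall>x\<in>{m+1}. c x = c (\<phi> x) \<or> c x = c m \<or> c (\<phi> x) = c m)" for c
  proof
    assume "rainbow_sum_free A c"
    then have "c (m + 1) = c (2 * m + 1) \<or> c (m + 1) = c m \<or> c (2 * m + 1) = c m"
      using assms by (intro rainbow_sum_free_triple[of A]) (auto simp: A_def)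
    then show "\<forall>x\<in>{m+1}. c x = c (\<phi> x) \<or> c x = c m \<or> c (\<phi> x) = c m" by (simp add: \<phi>_def)
  next
    assume *: "\<forall>x\<in>{m+1}. c x = c (\<phi> x) \<or> c x = c m \<or> c (\<phi> x) = c m"
    have "\<not> rainbow_sum A c x y z" for x y z
    proof
      assume xyz: "rainbow_sum A c x y z"
      then have "x = m \<and> y = m + 1 \<and> z = 2 * m + 1 \<or> x = m + 1 \<and> y = m \<and> z = 2 * m + 1"
        unfolding rainbow_sum_def A_def by auto
      then show False using xyz * unfolding rainbow_sum_def \<phi>_def by (auto simp flip: mult_2)
    qed
    then show "rainbow_sum_free A c" unfolding rainbow_sum_free_def by blast
  qed
  then have "g A r = card {c \<in> PiE A (\<lambda>_. {1..r}).
      \<forall>x\<in>{m+1}. c x = c (\<phi> x) \<or> c x = c m \<or> c (\<phi> x) = c m}"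
    unfolding g_def colorings_def by simp
  also have "\<dots> = card {1..r} * ((3 * r - 2) ^ card {m+1} *
      (\<Prod>x\<in>A - ({m+1} \<union> \<phi> ` {m+1}) - {m}. card {1..r}))"
    using assms by (intro card_PiE_star_free) (auto simp: A_def \<phi>_def)
  also have "\<dots> = r * ((3 * r - 2) * r ^ card (A - ({m+1} \<union> \<phi> ` {m+1}) - {m}))" by simp
  also have "A - ({m+1} \<union> \<phi> ` {m+1}) - {m} = {m+2..2*m}"
    unfolding A_def \<phi>_def by auto
  finally show ?thesis unfolding A_def using assms by (cases m) (auto simp: algebra_simps)
qed

section \<open>Fingerprints in the sum graph\<close>

lemma exists_maximal_card:
  assumes "finite \<T>" "\<T> \<noteq> {}"
  shows "\<exists>T\<in>\<T>. \<forall>T'\<in>\<T>. card T' \<le> card T"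
proof -
  have "Max (card ` \<T>) \<in> card ` \<T>" using assms by (intro Max_in) auto
  then obtain T where "T \<in> \<T>" "Max (card ` \<T>) = card T" by auto
  moreover have "card T' \<le> Max (card ` \<T>)" if "T' \<in> \<T>" for T' using that assms(1) by simp
  ultimately show ?thesis by metis
qed

lemma exists_matching:
  assumes fin: "finite X" and inj: "inj_on \<phi> X" and nofix: "\<And>x. x \<in> X \<Longrightarrow> \<phi> x \<noteq> x"
  obtains Q where "Q \<subseteq> X" "Q \<inter> \<phi> ` Q = {}" "card X \<le> 3 * card Q"
proof -
  define \<Q> where "\<Q> = {Q. Q \<subseteq> X \<and> Q \<inter> \<phi> ` Q = {}}"
  have "{} \<in> \<Q>" unfolding \<Q>_def by simp
  moreover have "finite \<Q>" unfolding \<Q>_def using fin by simp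
  ultimately obtain Q where "Q \<in> \<Q>" and max: "\<And>Q'. Q' \<in> \<Q> \<Longrightarrow> card Q' \<le> card Q"
    using exists_maximal_card[of \<Q>] by blast
  then have Q: "Q \<subseteq> X" "Q \<inter> \<phi> ` Q = {}" unfolding \<Q>_def by auto
  have finQ: "finite Q" using Q fin finite_subset by blast
  have "X \<subseteq> Q \<union> \<phi> ` Q \<union> {x\<in>X. \<phi> x \<in> Q}"
  proof (rule ccontr)
    assume "\<not> ?thesis"
    then obtain x where x: "x \<in> X" "x \<notin> Q" "x \<notin> \<phi> ` Q" "\<phi> x \<notin> Q" by blast
    then have "insert x Q \<in> \<Q>" using Q nofix[of x] unfolding \<Q>_def by force
    from max[OF this] show False using x(2) finQ by simp
  qed
  then have "card X \<le> card (Q \<union> \<phi> ` Q \<union> {x\<in>X. \<phi> x \<in> Q})"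
    using fin finQ by (intro card_mono) auto
  also have "\<dots> \<le> card Q + card (\<phi> ` Q) + card {x\<in>X. \<phi> x \<in> Q}"
    by (meson add_mono card_Un_le le_refl le_trans)
  also have "card (\<phi> ` Q) \<le> card Q" using finQ by (rule card_image_le)
  also have "card {x\<in>X. \<phi> x \<in> Q} \<le> card Q"
    using inj finQ by (intro card_inj_on_le[of \<phi>]) (auto simp: inj_on_def)
  finally show thesis using that[of Q] Q by simp
qed

lemma exists_star:
  fixes W :: "nat set"
  assumes fin: "finite W" "0 \<notin> W" and s: "0 < s"
    and many: "e < card {x\<in>W. x < s \<and> s - x \<in> W} \<or> e < card {x\<in>W. x + s \<in> W}"
  obtains Q \<phi> where "Q \<subseteq> W" "\<phi> ` Q \<subseteq> W" "inj_on \<phi> Q" "Q \<inter> \<phi> ` Q = {}" "s \<notin> Q" "s \<notin> \<phi> ` Q"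
    "e \<le> 3 * card Q" "\<And>x. x \<in> Q \<Longrightarrow> \<phi> x \<noteq> x \<and> (x + \<phi> x = s \<or> x + s = \<phi> x)"
  using many
proof
  assume A: "e < card {x\<in>W. x < s \<and> s - x \<in> W}"
  \<comment> \<open>Removing \<open>s div 2\<close> excludes the fixed point of the reflection. The
    one lost element turns \<open>e <\<close> into \<open>e \<le>\<close>.\<close>
  define X where "X = {x\<in>W. x < s \<and> s - x \<in> W} - {s div 2}"
  have X: "finite X" "inj_on (\<lambda>x. s - x) X" "\<And>x. x \<in> X \<Longrightarrow> s - x \<noteq> x"
    unfolding X_def using fin by (auto simp: inj_on_def)
  obtain Q where Q: "Q \<subseteq> X" "Q \<inter> (\<lambda>x. s - x) ` Q = {}" "card X \<le> 3 * card Q"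
    using exists_matching[OF X] by blast
  have "e \<le> card X" using A diff_card_le_card_Diff[of "{s div 2}" "{x\<in>W. x < s \<and> s - x \<in> W}"]
    unfolding X_def by simp
  then have "e \<le> 3 * card Q" using Q(3) by linarith
  moreover have QX: "x \<in> W" "s - x \<in> W" "x \<noteq> s" "s - x \<noteq> s" "s - x \<noteq> x" "x + (s - x) = s \<or> x + s = s - x"
    if "x \<in> Q" for x
  proof -
    have x: "x \<in> X" using that Q(1) by blast
    then have "0 < x" unfolding X_def using fin(2) by (auto intro!: gr0I)
    then show "x \<in> W" "s - x \<in> W" "x \<noteq> s" "s - x \<noteq> s" "s - x \<noteq> x" "x + (s - x) = s \<or> x + s = s - x"
      using x s X(3)[OF x] unfolding X_def by auto
  qed
  moreover have "s \<notin> (\<lambda>x. s - x) ` Q"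
  proof
    assume "s \<in> (\<lambda>x. s - x) ` Q"
    then obtain x where "x \<in> Q" "s = s - x" by blast
    then show False using QX(4)[of x] by metis
  qed
  moreover have "Q \<subseteq> W" "(\<lambda>x. s - x) ` Q \<subseteq> W" "s \<notin> Q" using QX(1,2,3) by blast+
  ultimately show thesis
    using Q(2) inj_on_subset[OF X(2) Q(1)] by (intro that[of Q "\<lambda>x. s - x"]) blast+
next
  assume A: "e < card {x\<in>W. x + s \<in> W}"
  \<comment> \<open>Here \<open>x = s\<close> is removed, since its pair would contain the
    center.\<close>
  define X where "X = {x\<in>W. x + s \<in> W} - {s}"
  have X: "finite X" "inj_on (\<lambda>x. x + s) X" "\<And>x. x \<in> X \<Longrightarrow> x + s \<noteq> x"
    unfolding X_def using fin s by (auto simp: inj_on_def)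
  obtain Q where Q: "Q \<subseteq> X" "Q \<inter> (\<lambda>x. x + s) ` Q = {}" "card X \<le> 3 * card Q"
    using exists_matching[OF X] by blast
  have "e \<le> card X" using A diff_card_le_card_Diff[of "{s}" "{x\<in>W. x + s \<in> W}"]
    unfolding X_def by simp
  then have "e \<le> 3 * card Q" using Q(3) by linarith
  moreover have QX: "x \<in> W" "x + s \<in> W" "x \<noteq> s" "x + s \<noteq> s" "x + s \<noteq> x" "x + (x + s) = s \<or> x + s = x + s"
    if "x \<in> Q" for x
  proof -
    have x: "x \<in> X" using that Q(1) by blast
    then have "0 < x" unfolding X_def using fin(2) by (auto intro!: gr0I)
    then show "x \<in> W" "x + s \<in> W" "x \<noteq> s" "x + s \<noteq> s" "x + s \<noteq> x" "x + (x + s) = s \<or> x + s = x + s"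
      using x s X(3)[OF x] unfolding X_def by auto
  qed
  moreover have "s \<notin> (\<lambda>x. x + s) ` Q"
  proof
    assume "s \<in> (\<lambda>x. x + s) ` Q"
    then obtain x where "x \<in> Q" "s = x + s" by blast
    then show False using QX(4)[of x] by metis
  qed
  moreover have "Q \<subseteq> W" "(\<lambda>x. x + s) ` Q \<subseteq> W" "s \<notin> Q" using QX(1,2,3) by blast+
  ultimately show thesis
    using Q(2) inj_on_subset[OF X(2) Q(1)] by (intro that[of Q "\<lambda>x. x + s"]) blast+
qed

lemma exists_top:
  fixes A :: "nat set"
  assumes "finite A" "d \<le> card A"
  obtains M where "M \<subseteq> A" "card M = d" "\<And>x y. x \<in> A - M \<Longrightarrow> y \<in> M \<Longrightarrow> x < y"
proof -
  have "\<exists>M\<subseteq>A. card M = d \<and> (\<forall>x\<in>A - M. \<forall>y\<in>M. x < y)" using assms(2)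
  proof (induction d)
    case 0
    then show ?case by (intro exI[of _ "{}"]) simp
  next
    case (Suc d)
    then obtain M where M: "M \<subseteq> A" "card M = d" "\<forall>x\<in>A - M. \<forall>y\<in>M. x < y" by auto
    have finM: "finite M" using M(1) assms(1) finite_subset by blast
    have "A - M \<noteq> {}" using M(1,2) Suc.prems by (metis Diff_eq_empty_iff not_less_eq_eq order_refl subset_antisym)
    then have m: "Max (A - M) \<in> A - M" using assms(1) by (intro Max_in) auto
    have m_le: "x \<le> Max (A - M)" if "x \<in> A - M" for x using that assms(1) by (intro Max_ge) auto
    show ?case
    proof (intro exI[of _ "insert (Max (A - M)) M"] conjI ballI)
      fix x y assume "x \<in> A - insert (Max (A - M)) M" "y \<in> insert (Max (A - M)) M"
      then show "x < y" using M(3) m_le[of x] by auto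
    qed (use m M finM in auto)
  qed
  then show thesis using that by blast
qed

section \<open>The sum graph and its fingerprints\<close>

text \<open>Adjacency in the graph in which \<open>x\<close> and \<open>y\<close> are joined when
  their sum lies in \<open>S\<close>. Loops are excluded because a rainbow sum has distinct
  elements.\<close>

definition nbrs :: "nat set \<Rightarrow> nat \<Rightarrow> nat set \<Rightarrow> nat set" where
  "nbrs S x V = {y\<in>V. y \<noteq> x \<and> x + y \<in> S}"

text \<open>For each \<open>z\<close> in \<open>S\<close>, both \<open>W \<union> P\<close> and the
  reflection of \<open>W\<close> in \<open>z\<close> lie in \<open>{1..<z}\<close>, so their sizes
  add up to at most \<open>z - 1\<close> plus the overlap. Overlaps are edges
  \<open>x + w = z\<close> with \<open>w\<close> in \<open>W\<close>; summed over \<open>z\<close>,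
  each edge is counted at its own sum only.\<close>

lemma sum_graph_weight_bound:
  assumes fin: "finite S" "finite W" "finite P" and disj: "W \<inter> P = {}" and S: "S \<subseteq> {1..n}"
    and below: "\<And>x z. x \<in> W \<union> P \<Longrightarrow> z \<in> S \<Longrightarrow> x < z" and pos: "0 \<notin> W \<union> P"
  shows "card S * (2 * card W + card P) \<le> card S * n + (\<Sum>x\<in>W \<union> P. card (nbrs S x W))"
proof -
  define R where "R = W \<union> P"
  have finR: "finite R" unfolding R_def using fin by simp
  have z: "2 * card W + card P \<le> n + card {x\<in>R. z - x \<in> nbrs S x W}" if z: "z \<in> S" for z
  proof -
    define V where "V = (\<lambda>x. z - x) ` W"
    have lt: "x < z" "0 < x" if "x \<in> R" for x
      using that below[of x z] z pos unfolding R_def by (auto intro!: gr0I)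
    have "inj_on (\<lambda>x. z - x) W" using lt(1) unfolding inj_on_def R_def
      by (metis UnCI diff_diff_cancel less_imp_le_nat)
    then have cV: "card V = card W" "finite V" unfolding V_def using fin by (auto simp: card_image)
    \<comment> \<open>The extra point \<open>z div 2\<close> accounts for \<open>x = w\<close>,
      which is not an edge. Its cost of one is absorbed by \<open>z - 1\<close>.\<close>
    have "R \<inter> V \<subseteq> insert (z div 2) {x\<in>R. z - x \<in> nbrs S x W}"
    proof
      fix x assume x: "x \<in> R \<inter> V"
      then obtain w where w: "w \<in> W" "x = z - w" unfolding V_def by blast
      have "w < z" using w lt unfolding R_def by blast
      then have "z - x = w" "x + w = z" using w by auto
      then show "x \<in> insert (z div 2) {x\<in>R. z - x \<in> nbrs S x W}"
        using w(1) x z unfolding nbrs_def by (cases "x = w") auto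
    qed
    then have "card (R \<inter> V) \<le> card (insert (z div 2) {x\<in>R. z - x \<in> nbrs S x W})"
      using finR by (intro card_mono) auto
    also have "\<dots> \<le> Suc (card {x\<in>R. z - x \<in> nbrs S x W})" by (simp add: card_insert_le_m1)
    finally have I: "card (R \<inter> V) \<le> Suc (card {x\<in>R. z - x \<in> nbrs S x W})" .
    have "R \<union> V \<subseteq> {1..<z}" using lt unfolding V_def R_def by force
    then have U: "card (R \<union> V) \<le> z - 1" using card_mono[of "{1..<z}"] by fastforce
    have "card R + card V = card (R \<union> V) + card (R \<inter> V)" using finR cV(2) by (rule card_Un_Int)
    moreover have "card R = card W + card P"
      unfolding R_def using fin disj by (simp add: card_Un_disjoint)
    moreover have "1 \<le> z" "z \<le> n" using z S by auto
    ultimately show ?thesis using I U cV(1) by linarith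
  qed
  have "card S * (2 * card W + card P) = (\<Sum>z\<in>S. 2 * card W + card P)" by simp
  also have "\<dots> \<le> (\<Sum>z\<in>S. n + card {x\<in>R. z - x \<in> nbrs S x W})" using z by (rule sum_mono)
  also have "\<dots> = card S * n + (\<Sum>z\<in>S. card {x\<in>R. z - x \<in> nbrs S x W})" by (simp add: sum.distrib)
  also have "(\<Sum>z\<in>S. card {x\<in>R. z - x \<in> nbrs S x W}) = (\<Sum>x\<in>R. card {z\<in>S. z - x \<in> nbrs S x W})"
    using fin(1) finR by (intro sum_multicount_gen) auto
  also have "\<dots> \<le> (\<Sum>x\<in>R. card (nbrs S x W))"
  proof (rule sum_mono)
    fix x assume x: "x \<in> R"
    have "inj_on (\<lambda>z. z - x) {z\<in>S. z - x \<in> nbrs S x W}"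
      using below[of x] x unfolding inj_on_def R_def
      by (metis (no_types, lifting) diff_add_inverse2 less_imp_le_nat le_add_diff_inverse2 mem_Collect_eq)
    then show "card {z\<in>S. z - x \<in> nbrs S x W} \<le> card (nbrs S x W)"
      by (rule card_inj_on_le) (auto simp: nbrs_def fin)
  qed
  finally show ?thesis unfolding R_def by simp
qed

definition uncov :: "nat set \<Rightarrow> nat set \<Rightarrow> nat set \<Rightarrow> nat set" where
  "uncov S V T = {x\<in>V. nbrs S x T = {}}"

text \<open>A fingerprint of maximal cardinality works: each vertex put into \<open>T\<close> covers at least
  \<open>n / K\<close> new vertices, so \<open>T\<close> has at most \<open>K\<close> of them.\<close>

lemma exists_fingerprint:
  assumes fin: "finite V" "card V \<le> n" "0 < n" and N: "N \<subseteq> V"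
  obtains T where "T \<subseteq> N" "card T \<le> K" "\<And>y. y \<in> N \<Longrightarrow> K * card (nbrs S y (uncov S V T)) < n"
proof -
  define \<T> where "\<T> = {T. T \<subseteq> N \<and> n * card T \<le> K * card (V - uncov S V T)}"
  have finN: "finite N" using N fin finite_subset by blast
  have "{} \<in> \<T>" unfolding \<T>_def by simp
  moreover have "finite \<T>" unfolding \<T>_def using finN by simp
  ultimately obtain T where T: "T \<in> \<T>" and max: "\<And>T'. T' \<in> \<T> \<Longrightarrow> card T' \<le> card T"
    using exists_maximal_card[of \<T>] by blast
  have finT: "finite T" using T finN finite_subset unfolding \<T>_def by blast
  show thesis
  proof
    show "T \<subseteq> N" using T unfolding \<T>_def by simp
    have "n * card T \<le> K * card (V - uncov S V T)" using T unfolding \<T>_def by simp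
    also have "\<dots> \<le> K * n"
      using fin by (intro mult_left_mono) (auto intro: le_trans[OF card_mono[of V]])
    finally show "card T \<le> K" using fin(3) by (simp add: mult.commute)
    fix y assume y: "y \<in> N"
    show "K * card (nbrs S y (uncov S V T)) < n"
    proof (rule ccontr)
      define B where "B = nbrs S y (uncov S V T)"
      assume "\<not> ?thesis"
      then have B: "n \<le> K * card B" unfolding B_def by simp
      then have "B \<noteq> {}" using fin(3) by auto
      \<comment> \<open>Neighbours of a vertex of \<open>T\<close> are covered, so a vertex of
        \<open>T\<close> has none in the uncovered set.\<close>
      then have "y \<notin> T" unfolding B_def nbrs_def uncov_def by (auto simp: add.commute)
      have "B \<subseteq> V" unfolding B_def nbrs_def uncov_def by auto
      then have finB: "finite B" using fin finite_subset by blast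
      have "(V - uncov S V T) \<union> B \<subseteq> V - uncov S V (insert y T)"
        unfolding B_def uncov_def nbrs_def by (auto simp: add.commute)
      then have "card ((V - uncov S V T) \<union> B) \<le> card (V - uncov S V (insert y T))"
        using fin by (intro card_mono) auto
      moreover have "card ((V - uncov S V T) \<union> B) = card (V - uncov S V T) + card B"
        using fin finB by (intro card_Un_disjoint) (auto simp: B_def nbrs_def)
      ultimately have "K * card (V - uncov S V T) + K * card B \<le> K * card (V - uncov S V (insert y T))"
        by (metis add_mult_distrib2 mult_le_mono2)
      moreover have "n * card (insert y T) = n * card T + n" using \<open>y \<notin> T\<close> finT by simp
      moreover have "n * card T \<le> K * card (V - uncov S V T)" using T unfolding \<T>_def by simp
      ultimately have "insert y T \<in> \<T>" unfolding \<T>_def using B y \<open>T \<subseteq> N\<close> by simp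
      from max[OF this] show False using \<open>y \<notin> T\<close> finT by simp
    qed
  qed
qed

lemma prod_palette_le:
  fixes pal :: "nat \<Rightarrow> nat set"
  assumes fin: "finite D" "finite W" "finite P" and WP: "W \<inter> P = {}"
    and W: "\<And>x. x \<in> D \<inter> W \<Longrightarrow> card (pal x) \<le> r" and P: "\<And>x. x \<in> D \<inter> P \<Longrightarrow> card (pal x) \<le> 2"
    and rest: "\<And>x. x \<in> D - (W \<union> P) \<Longrightarrow> card (pal x) \<le> 1"
  shows "(\<Prod>x\<in>D. card (pal x)) \<le> r ^ card (D \<inter> W) * 2 ^ card P"
proof -
  have "(\<Prod>x\<in>D. card (pal x)) \<le> (\<Prod>x\<in>D. (if x \<in> W then r else 1) * (if x \<in> P then 2 else 1))"
    using W P rest WP by (intro prod_mono) (auto split: if_splits)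
  also have "\<dots> = r ^ card (D \<inter> W) * 2 ^ card (D \<inter> P)"
    using fin by (simp add: prod.distrib prod.If_cases Int_def)
  also have "\<dots> \<le> r ^ card (D \<inter> W) * 2 ^ card P"
    using fin by (intro mult_left_mono power_increasing card_mono) auto
  finally show ?thesis .
qed

section \<open>Sets with a small element\<close>

lemma three_r_power_le_powr:
  assumes "r \<ge> (8::nat)"
  shows "real ((3 * r - 2) ^ q) \<le> real r powr (3 * real q / 2)"
proof -
  have "real ((3 * r - 2) ^ q) ^ 2 = real ((3 * r - 2)\<^sup>2) ^ q"
    by (simp flip: power_mult) (simp add: mult.commute)
  also have "\<dots> \<le> real (r ^ 3) ^ q"
    using three_r_sq_less_cube[OF assms] by (intro power_mono) (simp_all only: of_nat_le_iff less_imp_le of_nat_0_le_iff)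
  also have "\<dots> = real r powr (3 * real q)"
  proof -
    have "real (r ^ 3) ^ q = real r ^ (3 * q)" by (simp add: power_mult)
    also have "\<dots> = real r powr real (3 * q)" using assms by (intro powr_realpow[symmetric]) simp
    finally show ?thesis by simp
  qed
  also have "\<dots> = (real r powr (3 * real q / 2)) ^ 2"
    by (simp add: power2_eq_square flip: powr_add)
  finally show ?thesis by (rule power2_le_imp_le) simp
qed

text \<open>Here \<open>r \<ge> 8\<close> is used as
  \<open>2 = 8^(1/3) \<le> r^(1/3)\<close>.\<close>

lemma two_power_le_powr:
  assumes "r \<ge> (8::nat)"
  shows "2 ^ p \<le> real r powr (real p / 3)"
proof -
  have "(2::real) ^ p = 8 powr (real p / 3)"
  proof -
    have "(8::real) powr (real p / 3) = (2 powr 3) powr (real p / 3)" by simp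
    also have "\<dots> = 2 powr real p" by (simp only: powr_powr) simp
    finally show ?thesis by (simp add: powr_realpow)
  qed
  also have "\<dots> \<le> real r powr (real p / 3)" using assms by (intro powr_mono2) auto
  finally show ?thesis .
qed

text \<open>The exponent is set against the \<open>r^d\<close> colorings of the top part: saving
  \<open>3 * d / 2\<close> leaves a margin of \<open>d / 2\<close> for the polynomially many
  fingerprints. The saving comes from the palettes alone if \<open>P\<close> is large or
  \<open>W\<close> is small, and otherwise from a large star in \<open>W\<close>.\<close>

lemma container_size:
  fixes pal :: "nat \<Rightarrow> nat set"
  assumes r: "r \<ge> 8" and A: "A \<subseteq> {1..n}" "n + 2 \<le> 2 * card A" "a \<in> A" "3 * a \<le> n"
    and d: "0 < d" "5000 * d \<le> n"
    and WP: "W \<subseteq> A" "P \<subseteq> A" "W \<inter> P = {}" "2 * card W + card P \<le> n + d"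
    and palW: "\<And>x. x \<in> W \<Longrightarrow> pal x = {1..r}" and palP: "\<And>x. x \<in> P \<Longrightarrow> card (pal x) \<le> 2"
    and pal1: "\<And>x. x \<in> A - (W \<union> P) \<Longrightarrow> card (pal x) \<le> 1"
    and pal: "\<And>x. x \<in> A \<Longrightarrow> pal x \<subseteq> {1..r}"
  shows "real (card {c \<in> PiE A pal. rainbow_sum_free A c}) \<le> real r * real r powr ((real n - 3 * real d) / 2)"
proof -
  define F where "F = {c \<in> PiE A pal. rainbow_sum_free A c}"
  have finA: "finite A" using finite_subset[OF A(1)] by simp
  have fin: "finite A" "finite W" "finite P"
    using finA finite_subset[OF WP(1) finA] finite_subset[OF WP(2) finA] .
  have finp: "finite (pal x)" if "x \<in> A" for x using pal[OF that] finite_subset by blast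
  have finPiE: "finite (PiE A pal)" using fin(1) finp by (rule finite_PiE)
  define w where "w = real (card W)"
  define p where "p = real (card P)"
  have wp: "2 * w + p \<le> real n + real d" using WP(4) unfolding w_def p_def
    by (metis of_nat_add of_nat_le_iff of_nat_mult of_nat_numeral)
  have d': "0 < real d" "5000 * real d \<le> real n" using d by linarith+
  have r1: "1 < real r" using r by simp
  show ?thesis
  proof (cases "p \<ge> 12 * real d \<or> 2 * w + 24 * real d < real n")
    case True
    have "card F \<le> card (PiE A pal)" unfolding F_def using finPiE by (intro card_mono) auto
    also have "\<dots> = (\<Prod>x\<in>A. card (pal x))" using fin by (simp add: card_PiE)
    also have "\<dots> \<le> r ^ card (A \<inter> W) * 2 ^ card P"
      using palW palP pal1 by (intro prod_palette_le fin WP(3)) auto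
    also have "A \<inter> W = W" using WP(1) by auto
    finally have "real (card F) \<le> real (r ^ card W * 2 ^ card P)" by (simp only: of_nat_le_iff)
    also have "\<dots> = real r powr w * 2 ^ card P" using r1 unfolding w_def by (simp add: powr_realpow)
    also have "\<dots> \<le> real r powr w * real r powr (p / 3)"
      unfolding p_def by (intro mult_left_mono two_power_le_powr[OF r]) simp
    also have "\<dots> = real r powr (w + p / 3)" by (simp add: powr_add)
    also have "\<dots> \<le> real r powr ((real n - 3 * real d) / 2)"
    proof (rule powr_mono)
      \<comment> \<open>If \<open>p \<ge> 12 * d\<close>, write the left side as
        \<open>(2 * w + p) / 2 - p / 6\<close>; otherwise as
        \<open>w / 3 + (2 * w + p) / 3\<close>.\<close>
      show "w + p / 3 \<le> (real n - 3 * real d) / 2"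
        using True wp by (cases "12 * real d \<le> p") (auto simp: field_simps)
    qed (use r1 in simp)
    also have "\<dots> \<le> real r * real r powr ((real n - 3 * real d) / 2)"
      using r1 by simp
    finally show ?thesis unfolding F_def .
  next
    case False
    then have "real n \<le> 2 * w + 24 * real d" by simp
    then have dense: "n \<le> 2 * card W + 2 * (12 * d)" unfolding w_def by linarith
    \<comment> \<open>With \<open>k = e = 12 * d\<close> the size condition becomes
      \<open>2232 * d + 48 < n\<close>, which follows from \<open>5000 * d \<le> n\<close>.\<close>
    obtain s where s: "s \<in> A"
      "12 * d < card {x\<in>W. x < s \<and> s - x \<in> W} \<or> 12 * d < card {x\<in>W. x + s \<in> W}"
      using exists_many_sums[OF WP(1) A dense, of "12 * d"] d by auto
    have "0 \<notin> A" using A(1) by auto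
    then have W0: "0 \<notin> W" "0 < s" using WP(1) s(1) by (auto intro!: gr0I)
    obtain Q \<phi> where Q: "Q \<subseteq> W" "\<phi> ` Q \<subseteq> W" "inj_on \<phi> Q" "Q \<inter> \<phi> ` Q = {}" "s \<notin> Q" "s \<notin> \<phi> ` Q"
      "12 * d \<le> 3 * card Q" "\<And>x. x \<in> Q \<Longrightarrow> \<phi> x \<noteq> x \<and> (x + \<phi> x = s \<or> x + s = \<phi> x)"
      using exists_star[OF fin(2) W0 s(2)] by blast
    define q where "q = card Q"
    have finQ: "finite Q" using Q(1) fin(2) finite_subset by blast
    have QA: "Q \<subseteq> A" "\<phi> ` Q \<subseteq> A" using Q(1,2) WP(1) by auto
    define D where "D = A - (Q \<union> \<phi> ` Q) - {s}"
    have cQ: "card (Q \<union> \<phi> ` Q) = 2 * q"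
      unfolding q_def using Q(3,4) finQ by (simp add: card_Un_disjoint card_image)
    have QW: "Q \<union> \<phi> ` Q \<subseteq> W" using Q by auto
    have qW: "2 * q \<le> card W" using card_mono[OF fin(2) QW] cQ by simp
    have "card (D \<inter> W) \<le> card (W - (Q \<union> \<phi> ` Q))" unfolding D_def using fin by (intro card_mono) auto
    also have "\<dots> = card W - 2 * q" using QW finQ cQ by (simp add: card_Diff_subset)
    finally have DW: "card (D \<inter> W) \<le> card W - 2 * q" .
    have "F \<subseteq> {c \<in> PiE A pal. \<forall>x\<in>Q. c x = c (\<phi> x) \<or> c x = c s \<or> c (\<phi> x) = c s}"
    proof (intro subsetI CollectI conjI ballI)
      fix c assume c: "c \<in> F"
      then show "c \<in> PiE A pal" unfolding F_def by simp
      fix x assume x: "x \<in> Q"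
      then have "x \<in> A" "\<phi> x \<in> A" "x \<noteq> s" "\<phi> x \<noteq> s" "x \<noteq> \<phi> x" "x + \<phi> x = s \<or> x + s = \<phi> x"
        using QA Q(5,6) Q(8)[OF x] by auto
      then show "c x = c (\<phi> x) \<or> c x = c s \<or> c (\<phi> x) = c s"
        using rainbow_sum_free_triple[of A c x "\<phi> x" s] c s(1) unfolding F_def by blast
    qed
    then have "card F \<le> card {c \<in> PiE A pal. \<forall>x\<in>Q. c x = c (\<phi> x) \<or> c x = c s \<or> c (\<phi> x) = c s}"
      using finPiE by (intro card_mono) auto
    also have "\<dots> = card (pal s) * ((3 * r - 2) ^ card Q * (\<Prod>x\<in>D. card (pal x)))"
      unfolding D_def using QW palW pal
      by (intro card_PiE_star_free fin QA Q(3,4,5,6) s(1)) auto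
    also have "\<dots> \<le> r * ((3 * r - 2) ^ q * (r ^ (card W - 2 * q) * 2 ^ card P))"
    proof -
      have "card (pal s) \<le> r" using card_mono[OF _ pal[OF s(1)]] by simp
      moreover have "(\<Prod>x\<in>D. card (pal x)) \<le> r ^ card (D \<inter> W) * 2 ^ card P"
        using palW palP pal1 fin unfolding D_def by (intro prod_palette_le WP(3)) auto
      then have "(\<Prod>x\<in>D. card (pal x)) \<le> r ^ (card W - 2 * q) * 2 ^ card P"
        using DW r by (elim le_trans) (intro mult_right_mono power_increasing, auto)
      ultimately show ?thesis unfolding q_def by (intro mult_le_mono) auto
    qed
    finally have "real (card F) \<le> real (r * ((3 * r - 2) ^ q * (r ^ (card W - 2 * q) * 2 ^ card P)))"
      by (simp only: of_nat_le_iff)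
    also have "\<dots> = real r * (real ((3 * r - 2) ^ q) * (real r powr (w - 2 * real q) * 2 ^ card P))"
    proof -
      have "w - 2 * real q = real (card W - 2 * q)" using qW unfolding w_def by simp
      then have "real r powr (w - 2 * real q) = real r ^ (card W - 2 * q)"
        using r1 by (simp only: powr_realpow)
      then show ?thesis by simp
    qed
    also have "\<dots> \<le> real r * (real r powr (3 * real q / 2) * (real r powr (w - 2 * real q) * real r powr (p / 3)))"
      unfolding p_def by (intro mult_left_mono mult_mono three_r_power_le_powr two_power_le_powr r) auto
    also have "\<dots> = real r * real r powr (w + p / 3 - real q / 2)"
      by (simp flip: powr_add)
    also have "\<dots> \<le> real r * real r powr ((real n - 3 * real d) / 2)"
    proof (intro mult_left_mono powr_mono)
      \<comment> \<open>The palettes give at most \<open>w + p / 3 \<le> (n + d) / 2\<close>, and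
        the star saves \<open>q / 2 \<ge> 2 * d\<close>. The separate factor \<open>r\<close> pays
        for the color of \<open>s\<close>.\<close>
      have "4 * real d \<le> real q" using Q(7) unfolding q_def by linarith
      moreover have "0 \<le> p" unfolding p_def by simp
      ultimately show "w + p / 3 - real q / 2 \<le> (real n - 3 * real d) / 2"
        using wp by (simp add: field_simps)
    qed (use r1 in auto)
    finally show ?thesis unfolding F_def .
  qed
qed

section \<open>Containers described by codes\<close>

text \<open>Vertices with at least \<open>n / K\<close> uncovered neighbours. A fingerprint chosen
  among the vertices of color other than \<open>i\<close> leaves none of those heavy, so a heavy
  vertex must have color \<open>i\<close>.\<close>

definition heavy :: "nat \<Rightarrow> nat \<Rightarrow> nat set \<Rightarrow> nat set \<Rightarrow> nat set \<Rightarrow> nat set" where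
  "heavy n K S V T = {x\<in>V. n \<le> K * card (nbrs S x (uncov S V T))}"

text \<open>In a code \<open>(cM, i, ts)\<close>, \<open>cM\<close> is the coloring of the top part \<open>M\<close>, \<open>i\<close> its popular color, and
  \<open>ts\<close> lists the fingerprint vertices, none of color \<open>i\<close>, with their colors. A covered vertex \<open>x\<close>
  with neighbour \<open>t\<close> in the fingerprint has color \<open>i\<close> or the color of \<open>t\<close>.\<close>

definition palette :: "nat \<Rightarrow> nat \<Rightarrow> nat \<Rightarrow> nat set \<Rightarrow> nat set \<Rightarrow>
    (nat \<Rightarrow> nat) \<times> nat \<times> (nat \<times> nat) list \<Rightarrow> nat \<Rightarrow> nat set" where
  "palette n K r M V = (\<lambda>(cM, i, ts) x.
     let S = {s\<in>M. cM s = i}; T = fst ` set ts in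
     if x \<notin> V then {cM x}
     else if x \<in> heavy n K S V T then {i}
     else if x \<in> uncov S V T then {1..r}
     else {i, the (map_of ts (SOME t. t \<in> nbrs S x T))})"

lemma finite_palette: "finite (palette n K r M V code x)"
  unfolding palette_def by (simp add: Let_def split: prod.split)

text \<open>The last condition states that \<open>i\<close> is popular; it keeps \<open>S\<close>
  large enough for the weight bound to be useful.\<close>

definition codes :: "nat \<Rightarrow> nat \<Rightarrow> nat \<Rightarrow> nat set \<Rightarrow> ((nat \<Rightarrow> nat) \<times> nat \<times> (nat \<times> nat) list) set" where
  "codes n K r M = {(cM, i, ts). cM \<in> PiE M (\<lambda>_. {1..r}) \<and> i \<in> {1..r} \<and>
     set ts \<subseteq> {1..n} \<times> {1..r} \<and> length ts \<le> K \<and> card M \<le> r * card {s\<in>M. cM s = i}}"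

lemma exists_popular_color:
  assumes "finite M" "c \<in> PiE M (\<lambda>_. {1..r})" "0 < r"
  shows "\<exists>i\<in>{1..r}. card M \<le> r * card {s\<in>M. c s = i}"
proof (rule ccontr)
  assume *: "\<not> ?thesis"
  have "M = (\<Union>i\<in>{1..r}. {s\<in>M. c s = i})" using assms(2) by auto
  then have "card M \<le> (\<Sum>i\<in>{1..r}. card {s\<in>M. c s = i})" by (metis card_UN_le finite_atLeastAtMost)
  then have "r * card M \<le> (\<Sum>i\<in>{1..r}. r * card {s\<in>M. c s = i})"
    by (metis mult_le_mono2 sum_distrib_left)
  also have "\<dots> < (\<Sum>i\<in>{1..r}. card M)"
    using * assms(3) by (intro sum_strict_mono) (auto simp: not_le)
  finally show False by simp
qed

text \<open>Choose the fingerprint among the vertices of color other than \<open>i\<close>. If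
  \<open>x\<close> is adjacent to \<open>t\<close> in it, then \<open>x + t\<close> has color
  \<open>i\<close> and \<open>t\<close> has not, so \<open>x\<close> has color \<open>i\<close> or
  that of \<open>t\<close>.\<close>

lemma rainbow_sum_free_in_palette:
  assumes MV: "M \<inter> V = {}" "A = M \<union> V" "A \<subseteq> {1..n}" "0 < n" and r: "0 < r"
    and c: "c \<in> colorings A r" "rainbow_sum_free A c"
  shows "\<exists>code\<in>codes n K r M. c \<in> PiE A (palette n K r M V code)"
proof -
  have finA: "finite A" using finite_subset[OF MV(3)] by simp
  then have fin: "finite M" "finite V" using MV(2) by auto
  have cr: "c x \<in> {1..r}" if "x \<in> A" for x using c(1) that unfolding colorings_def by (rule PiE_mem)
  have cM: "restrict c M \<in> PiE M (\<lambda>_. {1..r})" using cr MV(2) by auto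
  then obtain i where i: "i \<in> {1..r}" "card M \<le> r * card {s\<in>M. restrict c M s = i}"
    using exists_popular_color[OF fin(1) _ r] by blast
  define S where "S = {s\<in>M. restrict c M s = i}"
  have "card V \<le> card {1..n}" using MV(2,3) by (intro card_mono) auto
  then have cV: "card V \<le> n" by simp
  obtain T where T: "T \<subseteq> {x\<in>V. c x \<noteq> i}" "card T \<le> K"
    "\<And>y. y \<in> {x\<in>V. c x \<noteq> i} \<Longrightarrow> K * card (nbrs S y (uncov S V T)) < n"
    using exists_fingerprint[OF fin(2) cV MV(4), of "{x\<in>V. c x \<noteq> i}" K S] by auto
  have finT: "finite T" by (rule finite_subset[OF T(1)]) (simp add: fin(2))
  define ts where "ts = map (\<lambda>t. (t, c t)) (sorted_list_of_set T)"
  have fst_ts: "fst ` set ts = T" unfolding ts_def using finT by (simp add: image_image)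
  have map_ts: "the (map_of ts t) = c t" if "t \<in> T" for t
    using that finT unfolding ts_def by (simp add: map_of_map_restrict)
  have "set ts \<subseteq> {1..n} \<times> {1..r}"
    unfolding ts_def using finT T(1) MV(2,3) cr by auto
  moreover have "length ts \<le> K" unfolding ts_def using T(2) by simp
  ultimately have code: "(restrict c M, i, ts) \<in> codes n K r M" unfolding codes_def using cM i by simp
  have "c x \<in> palette n K r M V (restrict c M, i, ts) x" if x: "x \<in> A" for x
  proof -
    have pal: "palette n K r M V (restrict c M, i, ts) x = (if x \<notin> V then {restrict c M x}
       else if x \<in> heavy n K S V T then {i} else if x \<in> uncov S V T then {1..r}
       else {i, the (map_of ts (SOME t. t \<in> nbrs S x T))})"
      unfolding palette_def S_def fst_ts[symmetric] by (simp add: Let_def)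
    consider "x \<notin> V" | "x \<in> heavy n K S V T" | "x \<in> uncov S V T" "x \<notin> heavy n K S V T"
      | "x \<in> V" "x \<notin> heavy n K S V T" "x \<notin> uncov S V T" by blast
    then show ?thesis
    proof cases
      case 1
      then show ?thesis using x MV(2) unfolding pal by simp
    next
      case 2
      then have "x \<in> V" "\<not> K * card (nbrs S x (uncov S V T)) < n" unfolding heavy_def by auto
      then have "c x = i" using T(3)[of x] by blast
      then show ?thesis using 2 \<open>x \<in> V\<close> unfolding pal by simp
    next
      case 3
      then have "x \<in> V" unfolding uncov_def by simp
      then show ?thesis using 3 cr[OF x] unfolding pal by simp
    next
      case 4
      define t where "t = (SOME t. t \<in> nbrs S x T)"
      have "nbrs S x T \<noteq> {}" using 4 unfolding uncov_def by simp
      then have "t \<in> nbrs S x T" unfolding t_def by (simp add: some_in_eq)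
      then have t: "t \<in> T" "t \<noteq> x" "x + t \<in> S" unfolding nbrs_def by auto
      then have tV: "t \<in> V" "c t \<noteq> i" "x + t \<in> M" "c (x + t) = i" using T(1) unfolding S_def by auto
      then have "c x = c t \<or> c x = c (x + t) \<or> c t = c (x + t)"
        using t x MV(1,2) 4(1) by (intro rainbow_sum_free_triple[OF c(2)]) auto
      then have "c x = i \<or> c x = c t" using tV by auto
      then show ?thesis using 4 map_ts[OF t(1)] unfolding pal t_def[symmetric] by simp
    qed
  qed
  moreover have "c x = undefined" if "x \<notin> A" for x
    using c(1) that unfolding colorings_def by (rule PiE_arb)
  ultimately have "c \<in> PiE A (palette n K r M V (restrict c M, i, ts))" by (intro PiE_I)
  then show ?thesis using code by blast
qed

lemma finite_codes: "finite M \<Longrightarrow> finite (codes n K r M)"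
  and card_codes_le: "finite M \<Longrightarrow> 0 < n \<Longrightarrow> 0 < r \<Longrightarrow>
    card (codes n K r M) \<le> r ^ card M * (r * ((K + 1) * (n * r) ^ K))"
proof -
  let ?L = "{ts. set ts \<subseteq> {1..n} \<times> {1..r} \<and> length ts \<le> K}"
  let ?B = "PiE M (\<lambda>_. {1..r}) \<times> {1..r} \<times> ?L"
  have sub: "codes n K r M \<subseteq> ?B" unfolding codes_def by auto
  assume fin: "finite M"
  then have finB: "finite ?B" by (intro finite_cartesian_product finite_PiE finite_lists_length_le) auto
  then show "finite (codes n K r M)" using sub finite_subset by blast
  assume "0 < n" "0 < r"
  have "card ?L = (\<Sum>i\<le>K. (n * r) ^ i)"
    by (subst card_lists_length_le) (auto simp: card_cartesian_product)
  also have "\<dots> \<le> (\<Sum>i\<le>K. (n * r) ^ K)"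
    using \<open>0 < n\<close> \<open>0 < r\<close> by (intro sum_mono power_increasing) auto
  finally have L: "card ?L \<le> (K + 1) * (n * r) ^ K" by simp
  have "card (codes n K r M) \<le> card ?B" using finB sub by (rule card_mono)
  also have "\<dots> = r ^ card M * (r * card ?L)" using fin by (simp add: card_cartesian_product card_PiE)
  also have "\<dots> \<le> r ^ card M * (r * ((K + 1) * (n * r) ^ K))" using L by (intro mult_le_mono) auto
  finally show "card (codes n K r M) \<le> r ^ card M * (r * ((K + 1) * (n * r) ^ K))" .
qed

text \<open>\<open>W\<close> consists of the uncovered light vertices and \<open>P\<close> of the
  covered light ones. Lightness bounds the degrees into \<open>W\<close>, so the weight bound
  supplies what \<open>container_size\<close> requires.\<close>

lemma card_palette_le:
  assumes r: "r \<ge> 8" and A: "A \<subseteq> {1..n}" "n + 2 \<le> 2 * card A" "a \<in> A" "3 * a \<le> n"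
    and d: "0 < d" "5000 * d \<le> n" "n \<le> 10000 * d"
    and MV: "M \<inter> V = {}" "A = M \<union> V" "card M = d" "\<And>x y. x \<in> V \<Longrightarrow> y \<in> M \<Longrightarrow> x < y"
    and K: "K = 10 ^ 8 * r" and code: "code \<in> codes n K r M"
  shows "real (card {c \<in> PiE A (palette n K r M V code). rainbow_sum_free A c})
    \<le> real r * real r powr ((real n - 3 * real d) / 2)"
proof -
  obtain cM i ts where code_eq: "code = (cM, i, ts)" by (cases code)
  define S where "S = {s\<in>M. cM s = i}"
  define T where "T = fst ` set ts"
  define U where "U = uncov S V T"
  define H where "H = heavy n K S V T"
  define W where "W = U - H"
  define P where "P = V - (U \<union> H)"
  have cM: "cM \<in> PiE M (\<lambda>_. {1..r})" "i \<in> {1..r}" "set ts \<subseteq> {1..n} \<times> {1..r}" "d \<le> r * card S"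
    using code MV(3) unfolding code_eq codes_def S_def by auto
  have sub: "U \<subseteq> V" "H \<subseteq> V" unfolding U_def H_def uncov_def heavy_def by auto
  then have WP: "W \<union> P \<subseteq> V" "W \<inter> P = {}" "W \<union> P \<union> H = V" "(W \<union> P) \<inter> H = {}"
    unfolding W_def P_def by auto
  have finA: "finite A" using finite_subset[OF A(1)] by simp
  then have fin: "finite M" "finite V" using MV(2) by auto
  have fin': "finite S" "finite W" "finite P" "finite U"
    using fin finite_subset[OF WP(1)] finite_subset[OF sub(1)] unfolding S_def by auto
  have pal: "palette n K r M V code x = (if x \<notin> V then {cM x} else if x \<in> H then {i}
     else if x \<in> U then {1..r} else {i, the (map_of ts (SOME t. t \<in> nbrs S x T))})" for x
    unfolding palette_def S_def H_def U_def T_def code_eq by (simp add: Let_def)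
  have weight: "2 * card W + card P \<le> n + d"
  proof -
    have "card (W \<union> P) \<le> card {1..n}" using WP(1) MV(2) A(1) by (intro card_mono) auto
    then have cWP: "card (W \<union> P) \<le> n" by simp
    have low: "K * card (nbrs S x W) \<le> n" if "x \<in> W \<union> P" for x
    proof -
      have "card (nbrs S x W) \<le> card (nbrs S x U)"
        using fin' by (intro card_mono) (auto simp: nbrs_def W_def)
      then have "K * card (nbrs S x W) \<le> K * card (nbrs S x U)" by (rule mult_le_mono2)
      also have "\<dots> < n" using that WP unfolding H_def U_def heavy_def by force
      finally show ?thesis by simp
    qed
    have "card S * (2 * card W + card P) \<le> card S * n + (\<Sum>x\<in>W \<union> P. card (nbrs S x W))"
      by (rule sum_graph_weight_bound) (use fin' WP MV A(1) in \<open>auto simp: S_def\<close>)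
    then have "K * (card S * (2 * card W + card P)) \<le>
        K * (card S * n) + (\<Sum>x\<in>W \<union> P. K * card (nbrs S x W))"
      by (metis add_mult_distrib2 mult_le_mono2 sum_distrib_left)
    also have "(\<Sum>x\<in>W \<union> P. K * card (nbrs S x W)) \<le> (\<Sum>x\<in>W \<union> P. n)" using low by (rule sum_mono)
    also have "\<dots> \<le> n * n" using cWP by simp
    \<comment> \<open>The value of \<open>K\<close> comes from here:
      \<open>n^2 \<le> 10^8 * d^2\<close> and \<open>d \<le> r * card S\<close> bound the total
      error by \<open>K * card S * d\<close>.\<close>
    also have "\<dots> \<le> (10000 * d) * (10000 * d)" using d(3) by (intro mult_le_mono)
    also have "\<dots> = 10 ^ 8 * d * d" by simp
    also have "\<dots> \<le> 10 ^ 8 * d * (r * card S)" using cM(4) by (rule mult_le_mono2)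
    also have "\<dots> = K * (card S * d)" unfolding K by simp
    finally have "(K * card S) * (2 * card W + card P) \<le> (K * card S) * (n + d)"
      by (simp add: algebra_simps)
    moreover have "0 < card S" using cM(4) d(1) by (auto intro!: gr0I)
    ultimately show ?thesis using K r by simp
  qed
  \<comment> \<open>On \<open>P\<close> a fingerprint neighbour exists, so the choice is genuine and
    the lookup never falls back to \<open>the None\<close>.\<close>
  have the_ts: "the (map_of ts (SOME t. t \<in> nbrs S x T)) \<in> {1..r}" if "x \<in> P" for x
  proof -
    have "nbrs S x T \<noteq> {}" using that unfolding P_def U_def uncov_def by auto
    then have "(SOME t. t \<in> nbrs S x T) \<in> nbrs S x T" by (simp add: some_in_eq)
    then have "(SOME t. t \<in> nbrs S x T) \<in> fst ` set ts" unfolding nbrs_def T_def by simp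
    then obtain y where "map_of ts (SOME t. t \<in> nbrs S x T) = Some y"
      by (metis map_of_eq_None_iff not_None_eq)
    then show ?thesis using cM(3) map_of_SomeD[of ts] by fastforce
  qed
  show ?thesis
  proof (rule container_size[OF r A d(1,2) _ _ WP(2) weight])
    show "W \<subseteq> A" "P \<subseteq> A" using WP(1) MV(2) by auto
    show "palette n K r M V code x = {1..r}" if "x \<in> W" for x
      using that sub unfolding pal W_def by auto
    show "card (palette n K r M V code x) \<le> 2" if "x \<in> P" for x
      using that unfolding pal P_def by (auto intro: le_trans[OF card_insert_le_m1])
    show "card (palette n K r M V code x) \<le> 1" if "x \<in> A - (W \<union> P)" for x
      using that WP(3) unfolding pal by auto
    show "palette n K r M V code x \<subseteq> {1..r}" if "x \<in> A" for x
    proof -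
      have "x \<in> M \<or> x \<in> V" "x \<in> V \<Longrightarrow> x \<in> W \<union> P \<union> H"
        using that MV(2) WP(3) by simp_all
      then consider "x \<in> M" "x \<notin> V" | "x \<in> H" | "x \<in> W" | "x \<in> P" by blast
      then show ?thesis
      proof cases
        case 1
        then show ?thesis using PiE_mem[OF cM(1)] unfolding pal by simp
      next
        case 4
        then show ?thesis using the_ts[OF 4] cM(2) unfolding pal P_def by simp
      qed (use cM(2) sub in \<open>auto simp: pal W_def\<close>)
    qed
  qed
qed

section \<open>Summing over all codes\<close>

text \<open>For \<open>z = x^(-1/K)\<close> the quotient of the two sides is
  \<open>C * (d * z^d)^K\<close>, which tends to 0.\<close>

lemma polynomial_less_exponential:
  fixes C x :: real
  assumes "1 < x" "0 < K"
  shows "\<exists>d0. \<forall>d\<ge>d0. C * real d ^ K < x ^ d"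
proof -
  define z where "z = x powr (- 1 / real K)"
  have z: "0 < z" "z < 1" unfolding z_def using assms by (auto simp: powr_less_one)
  have zK: "z ^ K = inverse x"
  proof -
    have "z ^ K = z powr real K" using z by (simp add: powr_realpow)
    also have "\<dots> = x powr (- 1 / real K * real K)" unfolding z_def by (rule powr_powr)
    also have "\<dots> = inverse x" using assms by (simp add: powr_minus)
    finally show ?thesis .
  qed
  have "(\<lambda>d. C * (real d * z ^ d) ^ K) \<longlonglongrightarrow> C * 0 ^ K"
    using z by (intro tendsto_intros powser_times_n_limit_0) auto
  moreover have "C * 0 ^ K = 0" using assms(2) by simp
  ultimately have "(\<lambda>d. C * (real d * z ^ d) ^ K) \<longlonglongrightarrow> 0" by (simp only:)
  then have "\<forall>\<^sub>F d in sequentially. C * (real d * z ^ d) ^ K < 1" by (rule order_tendstoD) simp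
  then obtain d0 where d0: "C * (real d * z ^ d) ^ K < 1" if "d \<ge> d0" for d
    unfolding eventually_sequentially by blast
  have "C * real d ^ K < x ^ d" if "d \<ge> d0" for d
  proof -
    have "(z ^ d) ^ K = (z ^ K) ^ d" by (simp add: mult.commute flip: power_mult)
    also have "\<dots> = inverse (x ^ d)" unfolding zK by (simp add: power_inverse)
    finally have "C * (real d * z ^ d) ^ K = C * real d ^ K / x ^ d"
      by (simp add: power_mult_distrib divide_inverse)
    then show ?thesis using d0[OF that] assms(1) by (simp add: divide_less_eq)
  qed
  then show ?thesis by blast
qed

lemma g_less_with_small_element:
  assumes r: "r \<ge> 8"
  shows "\<exists>n0. \<forall>n>n0. \<forall>A a. A \<subseteq> {1..n} \<longrightarrow> n + 2 \<le> 2 * card A \<longrightarrow> a \<in> A \<longrightarrow> 3 * a \<le> n \<longrightarrow>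
    real (g A r) < real r powr (real n / 2)"
proof -
  define K where "K = 10 ^ 8 * r"
  \<comment> \<open>\<open>C\<close> collects the factors independent of \<open>d\<close>, with
    \<open>n\<close> replaced by \<open>10000 * d\<close>. One \<open>r\<close> counts the popular
    color, the other the color of the star center.\<close>
  define C where "C = real r ^ 2 * (real K + 1) * (10000 * real r) ^ K"
  have r1: "1 < real r" using r by simp
  have "1 < real r powr (1 / 2)" using r1 by simp
  moreover have "0 < K" unfolding K_def using r by simp
  ultimately obtain d0 where d0: "C * real d ^ K < (real r powr (1 / 2)) ^ d" if "d \<ge> d0" for d
    using polynomial_less_exponential by blast
  have "real (g A r) < real r powr (real n / 2)"
    if n: "n > 5000 * d0 + 5000" and A: "A \<subseteq> {1..n}" "n + 2 \<le> 2 * card A" "a \<in> A" "3 * a \<le> n" for n A a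
  proof -
    define d where "d = n div 5000"
    have d: "0 < d" "5000 * d \<le> n" "n \<le> 10000 * d" "d0 \<le> d" 
    proof -
      have *: "5000 * d \<le> n" "n < 5000 * d + 5000"
        using div_mult_mod_eq[of n 5000] mod_less_divisor[of 5000 n] unfolding d_def by linarith+
      then have "d0 < d" using n by linarith
      then show "0 < d" "5000 * d \<le> n" "n \<le> 10000 * d" "d0 \<le> d" using * by linarith+
    qed
    have finA: "finite A" using finite_subset[OF A(1)] by simp
    have "d \<le> card A" using d(2) A(2) by linarith
    then obtain M where M: "M \<subseteq> A" "card M = d" "\<And>x y. x \<in> A - M \<Longrightarrow> y \<in> M \<Longrightarrow> x < y"
      using exists_top[OF finA] by blast
    define V where "V = A - M"
    have MV: "M \<inter> V = {}" "A = M \<union> V" using M(1) unfolding V_def by auto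
    have finM: "finite M" using finite_subset[OF M(1) finA] .
    define B where "B = real r * real r powr ((real n - 3 * real d) / 2)"
    let ?F = "\<lambda>code. {c \<in> PiE A (palette n K r M V code). rainbow_sum_free A c}"
    have "{c \<in> colorings A r. rainbow_sum_free A c} \<subseteq> (\<Union>code\<in>codes n K r M. ?F code)"
      using rainbow_sum_free_in_palette[OF MV A(1)] d(1,2) r by fastforce
    moreover have "finite (?F code)" for code
    proof -
      have "finite (PiE A (palette n K r M V code))" by (rule finite_PiE[OF finA finite_palette])
      then show ?thesis by simp
    qed
    ultimately have "g A r \<le> card (\<Union>code\<in>codes n K r M. ?F code)"
      unfolding g_def using finite_codes[OF finM] by (intro card_mono) blast+
    also have "\<dots> \<le> (\<Sum>code\<in>codes n K r M. card (?F code))"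
      using finite_codes[OF finM] by (rule card_UN_le)
    finally have "g A r \<le> (\<Sum>code\<in>codes n K r M. card (?F code))" .
    then have "real (g A r) \<le> (\<Sum>code\<in>codes n K r M. real (card (?F code)))"
      by (simp only: of_nat_sum[symmetric] of_nat_le_iff)
    also have "\<dots> \<le> (\<Sum>code\<in>codes n K r M. B)"
      unfolding B_def
      by (intro sum_mono card_palette_le[OF r A d(1-3) MV M(2) _ K_def])
        (use M(3) in \<open>auto simp: V_def\<close>)
    also have "\<dots> = real (card (codes n K r M)) * B" by simp
    also have "\<dots> \<le> real (r ^ d * (r * ((K + 1) * (n * r) ^ K))) * B"
      using card_codes_le[OF finM, of n r K] d r unfolding M(2) B_def
      by (intro mult_right_mono) (auto simp only: of_nat_le_iff, auto)
    also have "\<dots> \<le> real (r ^ d * (r * ((K + 1) * ((10000 * d) * r) ^ K))) * B"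
      using d(3) unfolding B_def
      by (intro mult_right_mono of_nat_mono mult_le_mono power_mono) auto
    also have "\<dots> = (C * real d ^ K) * (real r powr real d * real r powr ((real n - 3 * real d) / 2))"
      unfolding C_def B_def using r1
      by (simp add: powr_realpow power_mult_distrib power2_eq_square algebra_simps)
    \<comment> \<open>The exponent \<open>d + (n - 3 * d) / 2\<close> is
      \<open>n / 2 - d / 2\<close>; the missing \<open>r^(d/2)\<close> outweighs the
      polynomial.\<close>
    also have "\<dots> < (real r powr (1 / 2)) ^ d * (real r powr real d * real r powr ((real n - 3 * real d) / 2))"
      using d0[OF d(4)] r1 by (intro mult_strict_right_mono) auto
    also have "(real r powr (1 / 2)) ^ d = real r powr (real d / 2)"
      using r1 by (simp add: powr_powr flip: powr_realpow)
    also have "real r powr (real d / 2) * (real r powr real d * real r powr ((real n - 3 * real d) / 2)) =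
        real r powr (real n / 2)"
      by (simp flip: powr_add) (simp add: field_simps)
    finally show ?thesis .
  qed
  then show ?thesis by blast
qed

section \<open>The extremal sets\<close>

theorem mainTheorem5:
  fixes r :: nat
  assumes "r \<ge> 8"
  shows "\<exists>n0::nat. \<forall>n>n0. \<forall>A::nat set.
           A \<subseteq> {1..n} \<and> card A \<ge> nat \<lceil>real n / 2\<rceil> + 1 \<longrightarrow>
             (even n \<longrightarrow>
                g A r \<le> r ^ (nat \<lceil>real n / 2\<rceil> + 1) \<and>
                (g A r = r ^ (nat \<lceil>real n / 2\<rceil> + 1) \<longleftrightarrow> A = {n div 2..n})) \<and>
             (odd n \<longrightarrow>
                real (g A r) \<le> real r ^ nat \<lceil>real n / 2\<rceil> * (3 - 2 / real r) \<and>
                (real (g A r) = real r ^ nat \<lceil>real n / 2\<rceil> * (3 - 2 / real r) \<longleftrightarrow>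
                   A = {(n - 1) div 2..n}))"
proof -
  obtain n0 where n0: "real (g A r) < real r powr (real n / 2)"
    if "n > n0" "A \<subseteq> {1..n}" "n + 2 \<le> 2 * card A" "a \<in> A" "3 * a \<le> n" for n A a
    using g_less_with_small_element[OF assms] by metis
  have r1: "1 < real r" using assms by simp
  have even_case: "g A r \<le> r ^ (m + 1) \<and> (g A r = r ^ (m + 1) \<longleftrightarrow> A = {m..2*m})"
    if m: "2 * m > n0" and A: "A \<subseteq> {1..2*m}" "m + 1 \<le> card A" for m A
  proof (cases "A = {m..2*m}")
    case True
    then show ?thesis using g_upper_half_even[of m r] m by simp
  next
    case False
    have finA: "finite A" using finite_subset[OF A(1)] by simp
    \<comment> \<open>\<open>A\<close> has at least as many elements as this interval, so inclusion
      would mean equality. Hence \<open>Min A\<close> is below \<open>m\<close>.\<close>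
    have "\<not> A \<subseteq> {m..2*m}"
      using False A(2) card_seteq[of "{m..2*m}" A] by auto
    then obtain b where "b \<in> A" "b < m" using A(1) by fastforce
    define a where "a = Min A"
    have a: "a \<in> A" "\<And>x. x \<in> A \<Longrightarrow> a \<le> x \<and> x \<le> 2 * m"
      using finA \<open>b \<in> A\<close> A(1) unfolding a_def by (auto intro: Min_in)
    have "0 < a" "a < m" using a A(1) \<open>b \<in> A\<close> \<open>b < m\<close> by fastforce+
    have "g A r < r ^ (m + 1)"
    proof (cases "3 * a \<le> 2 * m")
      case True
      have "real (g A r) < real r powr (real (2 * m) / 2)"
        using n0[OF m A(1) _ a(1) True] A(2) by simp
      also have "\<dots> = real (r ^ m)" using r1 by (simp add: powr_realpow)
      also have "\<dots> \<le> real (r ^ (m + 1))" using r1 by simp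
      finally show ?thesis by (simp only: of_nat_less_iff)
    next
      case False
      then show ?thesis using g_less_even[OF assms a \<open>0 < a\<close> \<open>a < m\<close> _ A(2)] by simp
    qed
    then show ?thesis using False by simp
  qed
  \<comment> \<open>Requiring \<open>2 * m + 1 > n0 + 1\<close> forces \<open>0 < m\<close>, needed
    for the extremal count. The bound is the integer form of
    \<open>r^(m+1) * (3 - 2 / r)\<close>.\<close>
  have odd_case: "g A r \<le> r ^ m * (3 * r - 2) \<and> (g A r = r ^ m * (3 * r - 2) \<longleftrightarrow> A = {m..2*m+1})"
    if m: "2 * m + 1 > n0 + 1" and A: "A \<subseteq> {1..2*m+1}" "m + 2 \<le> card A" for m A
  proof (cases "A = {m..2*m+1}")
    case True
    then show ?thesis using g_upper_half_odd[of m r] m by simp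
  next
    case False
    have finA: "finite A" using finite_subset[OF A(1)] by simp
    have "\<not> A \<subseteq> {m..2*m+1}"
      using False A(2) card_seteq[of "{m..2*m+1}" A] by auto
    then obtain b where "b \<in> A" "b < m" using A(1) by fastforce
    define a where "a = Min A"
    have a: "a \<in> A" "\<And>x. x \<in> A \<Longrightarrow> a \<le> x \<and> x \<le> 2 * m + 1"
      using finA \<open>b \<in> A\<close> A(1) unfolding a_def by (auto intro: Min_in)
    have "0 < a" "a < m" using a A(1) \<open>b \<in> A\<close> \<open>b < m\<close> by fastforce+
    have "g A r < r ^ m * (3 * r - 2)"
    proof (cases "3 * a \<le> 2 * m + 1")
      case True
      have "real (g A r) < real r powr (real (2 * m + 1) / 2)"
        using n0[OF _ A(1) _ a(1) True] A(2) m by simp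
      also have "\<dots> \<le> real r powr real (m + 1)" using r1 by (intro powr_mono) auto
      also have "\<dots> = real (r ^ (m + 1))" using r1 by (simp only: powr_realpow of_nat_power)
      also have "\<dots> \<le> real (r ^ m * (3 * r - 2))"
        using assms by (simp only: of_nat_le_iff) simp
      finally show ?thesis by (simp only: of_nat_less_iff)
    next
      case False
      then show ?thesis using g_less_odd[OF assms a \<open>0 < a\<close> \<open>a < m\<close> _ A(2)] by simp
    qed
    then show ?thesis using False by simp
  qed
  show ?thesis
  proof (intro exI[of _ "n0 + 1"] allI impI conjI; elim conjE)
    fix n A assume n: "n > n0 + 1" and A: "A \<subseteq> {1..n}" "nat \<lceil>real n / 2\<rceil> + 1 \<le> card A"
    show "g A r \<le> r ^ (nat \<lceil>real n / 2\<rceil> + 1)"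
      "(g A r = r ^ (nat \<lceil>real n / 2\<rceil> + 1)) = (A = {n div 2..n})" if ev: "even n"
    proof -
      obtain m where m: "n = 2 * m" using ev by (elim evenE)
      have "nat \<lceil>real n / 2\<rceil> = m" "n div 2 = m" unfolding m by simp_all
      then show "g A r \<le> r ^ (nat \<lceil>real n / 2\<rceil> + 1)"
        "(g A r = r ^ (nat \<lceil>real n / 2\<rceil> + 1)) = (A = {n div 2..n})"
        using even_case[of m A] n A m by auto
    qed
    show "real (g A r) \<le> real r ^ nat \<lceil>real n / 2\<rceil> * (3 - 2 / real r)"
      "(real (g A r) = real r ^ nat \<lceil>real n / 2\<rceil> * (3 - 2 / real r)) = (A = {(n - 1) div 2..n})"
      if od: "odd n"
    proof -
      obtain m where m: "n = 2 * m + 1" using od by (elim oddE)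
      have "\<lceil>real n / 2\<rceil> = int m + 1" unfolding m by (simp add: ceiling_eq_iff)
      then have ceil: "nat \<lceil>real n / 2\<rceil> = m + 1" "(n - 1) div 2 = m" unfolding m by simp_all
      have "real r ^ (m + 1) * (3 - 2 / real r) = real r ^ m * (3 * real r - 2)"
        using r1 by (simp add: field_simps)
      also have "\<dots> = real (r ^ m * (3 * r - 2))" using assms by (simp add: of_nat_diff)
      finally show "real (g A r) \<le> real r ^ nat \<lceil>real n / 2\<rceil> * (3 - 2 / real r)"
        "(real (g A r) = real r ^ nat \<lceil>real n / 2\<rceil> * (3 - 2 / real r)) = (A = {(n - 1) div 2..n})"
        unfolding ceil using odd_case[of m A] n A ceil m by (simp_all only: of_nat_le_iff of_nat_eq_iff)
    qed
  qed
qed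

end
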